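(* Let $\mathbf{F}_q$ be a finite field, and let $X$ and $Y$ be matrices in $\mathrm{Mat}_n(\mathbf{F}_q)$ with the same class type. Let $\mathrm{Cent}\,X$ and $\mathrm{Cent}\,Y$ be the centralizers in $\mathrm{Mat}_n(\mathbf{F}_q)$ of $X$ and $Y$ respectively. Then $\mathrm{Cent}\,X$ and $\mathrm{Cent}\,Y$ are conjugate by an element of $\mathrm{GL}_n(\mathbf{F}_q)$.
   Context: A partition is a weakly decreasing finite sequence of positive integers $\lambda=(\lambda(1),\lambda(2),\dots)$, whose terms are its parts. Let $K$ be a field and $M\in\mathrm{Mat}_n(K)$. Let $f_1,\dots,f_t$ be the distinct monic irreducible factors over $K$ of the characteristic polynomial of $M$. For each $i$, let $\lambda_i$ be the partition such that the $f_i$-primary component of the $K[x]$-module $K^n$ (with $x$ acting as $M$) is isomorphic to $\bigoplus_j K[x]/(f_i^{\lambda_i(j)})$. The class type of $M$ is the formal string $\mathrm{ty}(M)=d_1^{\lambda_1}\cdots d_t^{\lambda_t}$, where $d_i=\deg f_i$; the order of the terms is unimportant (so the class type is the multiset of pairs $(d_i,\lambda_i)$). *)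

theory Defs
  imports
    "Jordan_Normal_Form.Char_Poly"
    "Jordan_Normal_Form.VS_Connect"
    "HOL-Algebra.QuotRing"
begin

definition is_partition :: "nat list \<Rightarrow> bool" where
  "is_partition lam \<longleftrightarrow> sorted_wrt (\<ge>) lam \<and> (\<forall>k\<in>set lam. k > 0)"

text \<open>
  Modules are records of \<^theory>\<open>HOL-Algebra.Module\<close>, over the polynomial ring
  \<open>class_ring :: 'a poly ring\<close>. Their fields \<open>mult\<close> and \<open>one\<close> play no role and are left
  \<^const>\<open>undefined\<close>, as in \<^const>\<open>module_vec\<close>.
\<close>

definition module_isomorphic ::
    "('r, 'c) ring_scheme \<Rightarrow> ('r, 'm, 'd) module_scheme \<Rightarrow> ('r, 'n, 'e) module_scheme \<Rightarrow> bool" where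
  "module_isomorphic R M N \<longleftrightarrow>
     (\<exists>h \<in> LinearCombinations.module_hom R M N. bij_betw h (carrier M) (carrier N))"

definition module_sum :: "'i set \<Rightarrow> ('i \<Rightarrow> ('r, 'm, 'd) module_scheme) \<Rightarrow> ('r, 'i \<Rightarrow> 'm) module" where
  \<comment> \<open>The direct product, which is the direct sum for finite \<open>I\<close>, the only case used below.\<close>
  "module_sum I M = \<lparr>
     carrier = (\<Pi>\<^sub>E i\<in>I. carrier (M i)),
     mult = undefined,
     one = undefined,
     zero = (\<lambda>i\<in>I. \<zero>\<^bsub>M i\<^esub>),
     add = (\<lambda>x y. \<lambda>i\<in>I. x i \<oplus>\<^bsub>M i\<^esub> y i),
     smult = (\<lambda>r x. \<lambda>i\<in>I. r \<odot>\<^bsub>M i\<^esub> x i) \<rparr>"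

definition quotient_module :: "('r, 'c) ring_scheme \<Rightarrow> 'r set \<Rightarrow> ('r, 'r set) module" where
  \<comment> \<open>The quotient \<open>R/I\<close> as an \<open>R\<close>-module: \<open>r\<close> acts as multiplication by its coset.\<close>
  "quotient_module R I = \<lparr>
     carrier = carrier (R Quot I),
     mult = undefined,
     one = undefined,
     zero = \<zero>\<^bsub>R Quot I\<^esub>,
     add = add (R Quot I),
     smult = (\<lambda>r C. (I +>\<^bsub>R\<^esub> r) \<otimes>\<^bsub>R Quot I\<^esub> C) \<rparr>"

definition poly_quotient :: "'a :: field poly \<Rightarrow> ('a poly, 'a poly set) module" where
  "poly_quotient g = quotient_module class_ring (PIdl\<^bsub>class_ring\<^esub> g)"

definition poly_act :: "'a :: field mat \<Rightarrow> 'a poly \<Rightarrow> 'a vec \<Rightarrow> 'a vec" where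
  \<comment> \<open>\<open>p(M) v\<close>\<close>
  "poly_act M p v =
     finsum_vec TYPE('a) (dim_row M) (\<lambda>i. coeff p i \<cdot>\<^sub>v ((M ^\<^sub>m i) *\<^sub>v v)) {..degree p}"

definition matrix_module :: "'a :: field mat \<Rightarrow> ('a poly, 'a vec) module" where
  \<comment> \<open>\<open>K\<^sup>n\<close> with \<open>x\<close> acting as the \<open>n \<times> n\<close> matrix \<open>M\<close>\<close>
  "matrix_module M = \<lparr>
     carrier = carrier_vec (dim_row M),
     mult = undefined,
     one = undefined,
     zero = 0\<^sub>v (dim_row M),
     add = (+),
     smult = poly_act M \<rparr>"

definition primary_component :: "('r, 'm) module \<Rightarrow> ('r, 'c) ring_scheme \<Rightarrow> 'r \<Rightarrow> ('r, 'm) module" where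
  "primary_component M R f =
     M \<lparr> carrier := {v \<in> carrier M. \<exists>k::nat. (f [^]\<^bsub>R\<^esub> k) \<odot>\<^bsub>M\<^esub> v = \<zero>\<^bsub>M\<^esub>} \<rparr>"

definition char_factors :: "'a :: field mat \<Rightarrow> 'a poly set" where
  "char_factors M = {f. lead_coeff f = 1 \<and> irreducible f \<and> f dvd char_poly M}"

definition is_primary_partition :: "'a :: field mat \<Rightarrow> 'a poly \<Rightarrow> nat list \<Rightarrow> bool" where
  "is_primary_partition M f lam \<longleftrightarrow>
     is_partition lam \<and>
     module_isomorphic class_ring
       (primary_component (matrix_module M) class_ring f)
       (module_sum {..<length lam} (\<lambda>j. poly_quotient (f ^ (lam ! j))))"

text \<open>
  The class type of \<open>M\<close>, as the multiset of pairs \<open>(d\<^sub>i, \<lambda>\<^sub>i)\<close>. It is given as a relation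
  between \<open>M\<close> and \<open>T\<close>; that each square matrix is related to exactly one \<open>T\<close> is the structure
  theorem for finitely generated modules over \<open>K[x]\<close>.
\<close>

definition has_class_type :: "'a :: field mat \<Rightarrow> (nat \<times> nat list) multiset \<Rightarrow> bool" where
  "has_class_type M T \<longleftrightarrow>
     (\<exists>lam. (\<forall>f \<in> char_factors M. is_primary_partition M f (lam f)) \<and>
            T = image_mset (\<lambda>f. (degree f, lam f)) (mset_set (char_factors M)))"

definition same_class_type :: "'a :: field mat \<Rightarrow> 'a mat \<Rightarrow> bool" where
  "same_class_type X Y \<longleftrightarrow> (\<exists>T. has_class_type X T \<and> has_class_type Y T)"

definition mat_centralizer :: "nat \<Rightarrow> 'a :: field mat \<Rightarrow> 'a mat set" where
  "mat_centralizer n X = {A \<in> carrier_mat n n. A * X = X * A}"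

end

theory Submission
  imports Defs
begin

text \<open>
  If \<open>f\<close> and \<open>g\<close> are irreducible of the same degree over a finite field, then \<open>f\<close> has a simple
  root in \<open>K[x]/(g)\<close>: there is \<open>a\<close> such that \<open>g\<close> divides \<open>f(a)\<close> exactly once, and
  consequently \<open>g\<^sup>j\<close> divides \<open>p(a)\<close> iff \<open>f\<^sup>j\<close> divides \<open>p\<close>. The Chinese remainder theorem
  provides one \<open>a\<close> for all pairs of corresponding factors of \<open>X\<close> and \<open>Y\<close>, so that \<open>p \<mapsto> p(a)\<close>
  carries the primary decomposition of \<open>X\<close> to that of \<open>Y\<close> and makes \<open>X\<close> similar to \<open>a(Y)\<close>.
  Since \<open>Cent Y\<close> is contained in \<open>Cent a(Y)\<close>, it is conjugate to a subset of \<open>Cent X\<close>; by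
  symmetry the two finite centralizers have the same cardinality, so the subset is everything.
\<close>

subsection \<open>Simple roots modulo irreducible polynomials over a finite field\<close>

text \<open>Equal degrees make K[x]/(f) and K[x]/(g) isomorphic only because K is finite: over the
  rationals the companion matrices of x^2 - 2 and x^2 - 3 have the same class type but
  non-isomorphic centralizers. Finiteness enters three times: counting residues yields a root, the
  vanishing in K of the number Q of residues makes the derivative of x^Q - x equal to -1, and the
  centralizers can be compared by cardinality. A root of f modulo g only identifies the residue
  fields. Simplicity lifts this to the quotients by f^j and g^j: if g^2 divided f(a), the
  equivalence would already fail for j = 2 and p = f. Being a simple root is a condition modulo g^2,
  so the parts of the partitions do not enter the choice of a. The map p -> p(a) is never inverted.
  The exact match of divisibilities gives a well-defined injective map on K^n, K-linear because
  composition fixes constants, and injectivity suffices in finite dimension. Likewise counting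
  replaces the argument that Y is itself a polynomial in a(Y).\<close>

lemma irreducible_bezout:
  fixes f c :: "'a :: field poly"
  assumes f: "irreducible f" and nd: "\<not> f dvd c"
  shows "\<exists>u v. u * f + v * c = 1"
proof -
  define I where "I = {u * f + v * c | u v. True}"
  have f0: "f \<noteq> 0" using f by auto
  have "f = 1 * f + 0 * c" by simp
  hence fI: "f \<in> I" unfolding I_def by blast
  have "c = 0 * f + 1 * c" by simp
  hence cI: "c \<in> I" unfolding I_def by blast
  \<comment> \<open>By division with remainder, a nonzero element of least degree divides everything
    in the ideal \<open>I\<close>. As a common divisor of \<open>f\<close> and \<open>c\<close> it
    can only be a unit.\<close>
  obtain d where d: "d \<in> I" "d \<noteq> 0" and min: "\<And>e. e \<in> I \<Longrightarrow> e \<noteq> 0 \<Longrightarrow> degree d \<le> degree e"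
    using ex_has_least_nat[of "\<lambda>e. e \<in> I \<and> e \<noteq> 0" f degree] fI f0 by auto
  have dvd: "d dvd e" if e: "e \<in> I" for e
  proof -
    obtain u v where 1: "d = u * f + v * c" using d unfolding I_def by auto
    obtain u' v' where 2: "e = u' * f + v' * c" using e unfolding I_def by auto
    have "e mod d = e - (e div d) * d" by (simp add: minus_div_mult_eq_mod)
    also have "\<dots> = (u' - (e div d) * u) * f + (v' - (e div d) * v) * c"
    proof -
      have "(e div d) * d = (e div d) * (u * f + v * c)" using 1 by simp
      thus ?thesis using 2 by (simp add: algebra_simps)
    qed
    finally have "e mod d \<in> I" unfolding I_def by blast
    hence "e mod d = 0 \<or> degree d \<le> degree (e mod d)" using min by blast
    thus ?thesis using degree_mod_less[OF d(2), of e] by auto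
  qed
  obtain k where k: "f = d * k" using dvd[OF fI] unfolding dvd_def by auto
  have "\<not> k dvd 1"
  proof
    assume "k dvd 1"
    hence "f dvd d" using k by (metis dvd_refl mult.right_neutral mult_unit_dvd_iff)
    with dvd[OF cI] nd show False by (meson dvd_trans)
  qed
  hence "d dvd 1" using irreducibleD[OF f k] by auto
  then obtain m where m: "1 = d * m" unfolding dvd_def by auto
  obtain u v where "d = u * f + v * c" using d unfolding I_def by auto
  hence "(m * u) * f + (m * v) * c = 1" using m by (simp add: algebra_simps)
  thus ?thesis by blast
qed

text \<open>Multiply the identity for exponent \<open>k\<close> by the one for exponent 1: the only
  term without the factor \<open>c\<close> carries f^(k+1). This is the coprimality behind both the
  Chinese remainder step and the primary decomposition.\<close>

lemma irreducible_power_bezout: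
  fixes f c :: "'a :: field poly"
  assumes f: "irreducible f" and nd: "\<not> f dvd c"
  shows "\<exists>u v. u * f ^ k + v * c = 1"
proof (induction k)
  case 0
  show ?case by (rule exI[of _ 1], rule exI[of _ 0]) simp
next
  case (Suc k)
  then obtain u v where 1: "u * f ^ k + v * c = 1" by blast
  obtain u' v' where 2: "u' * f + v' * c = 1" using irreducible_bezout[OF f nd] by blast
  have "(u * u') * f ^ Suc k + (u * f ^ k * v' + v * u' * f + v * c * v') * c
      = (u * f ^ k + v * c) * (u' * f + v' * c)" by (simp add: algebra_simps)
  thus ?case unfolding 1 2 by (metis mult_1)
qed

lemma prime_elem_if_irreducible_poly:
  fixes f :: "'a :: field poly"
  assumes f: "irreducible f"
  shows "prime_elem f"
proof (rule prime_elemI)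
  show "f \<noteq> 0" "\<not> is_unit f" using f by (auto simp: irreducible_def)
  fix a b assume ab: "f dvd a * b"
  show "f dvd a \<or> f dvd b"
  proof (rule disjCI)
    assume "\<not> f dvd b"
    then obtain u v where "u * f + v * b = 1" using irreducible_bezout[OF f] by blast
    hence "a = (u * a) * f + v * (a * b)" by (metis (no_types) mult.assoc mult.commute mult.right_neutral distrib_left)
    thus "f dvd a" using ab by (metis dvd_add dvd_mult dvd_triv_right)
  qed
qed

lemma prime_elem_dvd_prod:
  assumes "prime_elem g" "finite S" "g dvd prod F S"
  shows "\<exists>x\<in>S. g dvd F x"
  using assms(2,3)
proof (induction S)
  case empty
  thus ?case using assms(1) by (simp add: prime_elem_def)
next
  case (insert x S)
  thus ?case using assms(1) by (auto simp: prime_elem_dvd_mult_iff)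
qed

text \<open>Lagrange's bound on the number of roots in the domain R/(g), phrased through
  divisibility so that no quotient ring is formed. Splitting off the linear factor of one root keeps
  the other roots, because \<open>g\<close> is prime and divides none of the differences.\<close>

lemma dvd_coeff_if_many_roots_mod:
  fixes F :: "'a :: idom poly"
  assumes g: "prime_elem g" and "finite S"
    and "\<And>a. a \<in> S \<Longrightarrow> g dvd poly F a"
    and "\<And>a b. a \<in> S \<Longrightarrow> b \<in> S \<Longrightarrow> g dvd a - b \<Longrightarrow> a = b"
    and "degree F < card S"
  shows "g dvd coeff F i"
  using assms(2-)
proof (induction "degree F" arbitrary: F S i rule: less_induct)
  case less
  then obtain a where a: "a \<in> S" by (metis card.empty equals0I less_zeroE)
  have F: "F = [:- a, 1:] * synthetic_div F a + [:poly F a:]"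
    using synthetic_div_correct'[of a F] by simp
  have ga: "g dvd poly F a" using less.prems(2) a .
  show ?case
  proof (cases "degree F = 0")
    case True
    then obtain c where "F = [:c:]" by (auto elim: degree_eq_zeroE)
    thus ?thesis using ga by (cases i) auto
  next
    case False
    define H where "H = synthetic_div F a"
    have degH: "degree H < degree F" using False unfolding H_def by (simp add: degree_synthetic_div)
    have H: "g dvd coeff H j" for j
    proof (rule less.hyps[OF degH, of "S - {a}"])
      show "finite (S - {a})" using less.prems by simp
      show "degree H < card (S - {a})" using a less.prems degH False
        by (simp add: card_Diff_singleton H_def degree_synthetic_div)
      show "b = c" if "b \<in> S - {a}" "c \<in> S - {a}" "g dvd b - c" for b c
        using less.prems(3) that by blast
      fix b assume b: "b \<in> S - {a}"
      have "poly F b = (b - a) * poly H b + poly F a"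
        by (subst F) (simp add: H_def algebra_simps)
      moreover have "g dvd poly F b" using less.prems(2) b by blast
      ultimately have "g dvd (b - a) * poly H b" using ga by (metis dvd_add_left_iff)
      moreover have "\<not> g dvd b - a" using less.prems(3)[of b a] a b by blast
      ultimately show "g dvd poly H b" using g by (simp add: prime_elem_dvd_mult_iff)
    qed
    have "coeff F i = (case i of 0 \<Rightarrow> 0 | Suc j \<Rightarrow> coeff H j) - a * coeff H i + coeff [:poly F a:] i"
      by (subst F) (simp add: H_def coeff_pCons split: nat.split)
    thus ?thesis using H ga by (auto simp: coeff_pCons split: nat.split)
  qed
qed

section \<open>Residues modulo an irreducible polynomial over a finite field\<close>

lemma finite_degree_less: "finite {p :: 'a :: {comm_monoid_add, finite} poly. degree p < d}"
proof (rule finite_subset)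
  show "{p :: 'a poly. degree p < d} \<subseteq> Poly ` {xs. set xs \<subseteq> UNIV \<and> length xs \<le> d}"
  proof
    fix p :: "'a poly" assume "p \<in> {p. degree p < d}"
    hence "length (coeffs p) \<le> d" by (auto simp: length_coeffs_degree Suc_le_eq)
       (metis Suc_leI coeffs_eq_Nil length_coeffs_degree list.size(3) mem_Collect_eq zero_le)
    thus "p \<in> Poly ` {xs. set xs \<subseteq> UNIV \<and> length xs \<le> d}"
      by (intro image_eqI[of _ _ "coeffs p"]) auto
  qed
  show "finite (Poly ` {xs :: 'a list. set xs \<subseteq> UNIV \<and> length xs \<le> d})"
    by (intro finite_imageI finite_lists_length_le) simp
qed

lemma irreducible_degree_pos:
  fixes g :: "'a :: field poly"
  assumes "irreducible g"
  shows "0 < degree g"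
proof -
  have "g \<noteq> 0" "\<not> g dvd 1" using assms by (auto simp: irreducible_def)
  thus ?thesis by (simp add: is_unit_iff_degree)
qed

lemma dvd_diff_imp_eq:
  fixes g :: "'a :: field poly"
  assumes "g dvd a - b" "degree a < degree g" "degree b < degree g"
  shows "a = b"
proof (rule ccontr)
  assume "a \<noteq> b"
  hence "degree g \<le> degree (a - b)" using assms(1) by (intro dvd_imp_degree_le) auto
  thus False using degree_diff_less[OF assms(2,3)] by simp
qed

text \<open>Fermat's little theorem in the field K[x]/(g), represented by the polynomials of degree
  below \<open>degree g\<close>: multiplication by \<open>a\<close> permutes the nonzero residues,
  and comparing their products before and after gives a^(Q-1) = 1 modulo \<open>g\<close>, where Q
  is the number of residues.\<close>

lemma residue_power_card:
  fixes g a :: "'a :: {field, finite} poly"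
  assumes g: "irreducible g"
  shows "g dvd a ^ card {p :: 'a poly. degree p < degree g} - a"
proof -
  let ?R = "{p :: 'a poly. degree p < degree g}"
  define S where "S = ?R - {0}"
  have finR: "finite ?R" by (rule finite_degree_less)
  have finS: "finite S" using finR S_def by auto
  have pr: "prime_elem g" using prime_elem_if_irreducible_poly[OF g] .
  have d: "0 < degree g" using irreducible_degree_pos[OF g] .
  have "card ?R = Suc (card S)" unfolding S_def by (rule card.remove[OF finR]) (use d in simp)
  hence pw: "a ^ card ?R - a = a * (a ^ card S - 1)" by (simp add: algebra_simps)
  have ndS: "\<not> g dvd b" if "b \<in> S" for b
    using that unfolding S_def by (auto dest: dvd_imp_degree_le)
  show ?thesis
  proof (cases "g dvd a")
    case True
    thus ?thesis unfolding pw by simp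
  next
    case False
    let ?m = "\<lambda>b. (a * b) mod g"
    have inj: "inj_on ?m S"
    proof (rule inj_onI)
      fix b c assume bc: "b \<in> S" "c \<in> S" "?m b = ?m c"
      hence "g dvd a * (b - c)" by (simp add: mod_eq_dvd_iff right_diff_distrib)
      hence "g dvd b - c" using pr False by (simp add: prime_elem_dvd_mult_iff)
      thus "b = c" using bc dvd_diff_imp_eq unfolding S_def by auto
    qed
    have sub: "?m ` S \<subseteq> S"
    proof
      fix x assume "x \<in> ?m ` S"
      then obtain b where b: "b \<in> S" "x = ?m b" by auto
      have "\<not> g dvd a * b" using pr False ndS[OF b(1)] by (simp add: prime_elem_dvd_mult_iff)
      hence "x \<noteq> 0" using b by (simp add: mod_eq_0_iff_dvd)
      thus "x \<in> S" using b degree_mod_less[of g "a * b"] d g unfolding S_def by auto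
    qed
    have "bij_betw ?m S S" using inj sub finS by (simp add: bij_betw_def endo_inj_surj)
    hence "(\<Prod>b\<in>S. ?m b) = \<Prod>S" by (rule prod.reindex_bij_betw[of _ _ _ "\<lambda>x. x"])
    hence "\<Prod>S mod g = (\<Prod>b\<in>S. ?m b) mod g" by simp
    also have "\<dots> = (\<Prod>b\<in>S. a * b) mod g" by (rule mod_prod_eq)
    also have "(\<Prod>b\<in>S. a * b) = a ^ card S * \<Prod>S" by (simp add: prod.distrib)
    finally have "g dvd a ^ card S * \<Prod>S - \<Prod>S" unfolding mod_eq_dvd_iff[symmetric] by (rule sym)
    hence "g dvd (a ^ card S - 1) * \<Prod>S" by (simp add: algebra_simps)
    moreover have "\<not> g dvd \<Prod>S" using prime_elem_dvd_prod[OF pr finS] ndS by auto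
    ultimately have "g dvd a ^ card S - 1" using pr by (simp add: prime_elem_dvd_mult_iff)
    thus ?thesis unfolding pw by simp
  qed
qed

text \<open>Adding 1 permutes the residues, so their sum is unchanged, while termwise it grows by
  their number. This avoids identifying the number as a power of |K|.\<close>

lemma of_nat_card_degree_less:
  assumes "0 < d"
  shows "of_nat (card {p :: 'a :: {field, finite} poly. degree p < d}) = (0 :: 'a poly)"
proof -
  let ?R = "{p :: 'a poly. degree p < d}"
  have "bij_betw (\<lambda>p. p + 1) ?R ?R"
    by (rule bij_betw_byWitness[where f' = "\<lambda>p. p - 1"]) (use assms in \<open>auto intro: degree_add_less degree_diff_less\<close>)
  hence "(\<Sum>p\<in>?R. p + 1) = \<Sum>?R" by (rule sum.reindex_bij_betw[of _ _ _ "\<lambda>x. x"])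
  thus ?thesis by (simp add: sum.distrib)
qed

section \<open>Composition of polynomials and congruences\<close>

lemma pcompose_dvd_diff:
  fixes f a b :: "'a :: comm_ring_1 poly"
  shows "a - b dvd pcompose f a - pcompose f b"
proof (induction f)
  case (pCons c f)
  have "pcompose (pCons c f) a - pcompose (pCons c f) b
     = (a - b) * pcompose f a + b * (pcompose f a - pcompose f b)"
    by (simp add: pcompose_pCons algebra_simps)
  thus ?case using pCons by simp
qed simp

text \<open>First-order Taylor expansion, used with \<open>h\<close> = \<open>g\<close> to compare
  the roots \<open>a\<close> and \<open>a + g\<close> modulo the square of \<open>g\<close>.\<close>

lemma pcompose_taylor_dvd:
  fixes f a h :: "'a :: idom poly"
  shows "h\<^sup>2 dvd pcompose f (a + h) - (pcompose f a + pcompose (pderiv f) a * h)"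
proof (induction f)
  case (pCons c f)
  then obtain k where k: "pcompose f (a + h) = pcompose f a + pcompose (pderiv f) a * h + h\<^sup>2 * k"
    by (metis add.commute diff_eq_eq dvdE)
  have "pcompose (pCons c f) (a + h) - (pcompose (pCons c f) a + pcompose (pderiv (pCons c f)) a * h)
     = h\<^sup>2 * (pcompose (pderiv f) a + (a + h) * k)"
    by (simp add: pcompose_pCons pderiv_pCons pcompose_add k algebra_simps power2_eq_square)
  thus ?case by (metis dvd_triv_left)
qed simp

lemma pcompose_power: "pcompose (p ^ k) (a :: 'a :: comm_semiring_1 poly) = pcompose p a ^ k"
  by (induction k) (simp_all add: pcompose_mult pcompose_1)

text \<open>Every residue modulo \<open>g\<close> is a root of \<open>x ^ Q - x\<close>, which \<open>f\<close> divides, so the cofactor of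
  \<open>f\<close> cannot account for all of them.\<close>

lemma exists_simple_root_mod:
  fixes f g :: "'a :: {field, finite} poly"
  assumes f: "irreducible f" and g: "irreducible g" and deg: "degree f = degree g"
  shows "\<exists>a. g dvd pcompose f a \<and> \<not> g\<^sup>2 dvd pcompose f a"
proof -
  let ?R = "{p :: 'a poly. degree p < degree g}"
  define Q where "Q = card ?R"
  have d: "0 < degree g" using irreducible_degree_pos[OF g] .
  have pr: "prime_elem g" using prime_elem_if_irreducible_poly[OF g] .
  have fin: "finite ?R" by (rule finite_degree_less)
  \<comment> \<open>Both 0 and 1 are residues. With Q at least 2, x^Q dominates x, so x^Q - x has
    degree exactly Q.\<close>
  have "card {0, 1 :: 'a poly} \<le> Q" unfolding Q_def using fin d by (intro card_mono) auto
  hence Q2: "2 \<le> Q" by simp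
  define x where "x = [:0, 1 :: 'a:]"
  have "f dvd x ^ Q - x" unfolding Q_def deg[symmetric] by (rule residue_power_card[OF f])
  then obtain s where s: "x ^ Q - x = f * s" unfolding dvd_def by auto
  have comp_x: "pcompose f a * pcompose s a = a ^ Q - a" for a
  proof -
    have "pcompose f a * pcompose s a = pcompose (x ^ Q - x) a"
      by (simp add: s pcompose_mult)
    thus ?thesis by (simp add: pcompose_diff pcompose_power x_def pcompose_pCons)
  qed
  have "degree (x ^ Q - x) = Q"
  proof -
    have "degree (x ^ Q) = Q" by (simp add: x_def degree_power_eq)
    moreover have "degree x < Q" using Q2 by (simp add: x_def)
    ultimately show ?thesis by (simp add: degree_add_eq_left[of "- x", simplified])
  qed
  hence degfs: "degree (f * s) = Q" unfolding s .
  hence nz: "f * s \<noteq> 0" using Q2 by auto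
  have degs: "degree f + degree s = Q" using nz degfs by (simp add: degree_mult_eq)
  have "\<exists>a. g dvd pcompose f a"
  proof (rule ccontr)
    assume no: "\<nexists>a. g dvd pcompose f a"
    \<comment> \<open>\<open>F\<close> is \<open>s\<close> read as a polynomial over K[x], so that
      evaluating it at a residue is composing \<open>s\<close> with it. If \<open>f\<close> had no
      root modulo \<open>g\<close>, all Q residues would be roots of \<open>F\<close>, whose degree
      is below Q; then \<open>g\<close> would divide the leading coefficient of \<open>s\<close>, a
      nonzero constant.\<close>
    define F where "F = map_poly (\<lambda>c. [:c:]) s"
    have "g dvd coeff F (degree s)"
    proof (rule dvd_coeff_if_many_roots_mod[OF pr fin])
      fix a assume "a \<in> ?R"
      have "g dvd pcompose f a * pcompose s a" unfolding comp_x Q_def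
        by (rule residue_power_card[OF g])
      thus "g dvd poly F a" using no pr unfolding F_def pcompose_altdef
        by (simp add: prime_elem_dvd_mult_iff)
    next
      have "degree F \<le> degree s" unfolding F_def by (rule degree_map_poly_le)
      thus "degree F < card ?R" using degs d deg unfolding Q_def by linarith
    qed (use dvd_diff_imp_eq in auto)
    hence "g dvd [:lead_coeff s:]" unfolding F_def by (simp add: coeff_map_poly)
    moreover have "lead_coeff s \<noteq> 0" using nz by auto
    ultimately show False using d by (metis degree_pCons_0 dvd_imp_degree_le leD pCons_eq_0_iff)
  qed
  then obtain a where a: "g dvd pcompose f a" by blast
  \<comment> \<open>A common root of \<open>f\<close> and its derivative modulo \<open>g\<close>
    would be a root of the derivative of \<open>f * s\<close>, that is of x^Q - x; but this
    derivative is -1, as Q vanishes in K.\<close>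
  have "\<not> g dvd pcompose (pderiv f) a"
  proof
    assume "g dvd pcompose (pderiv f) a"
    hence "g dvd pcompose (pderiv (f * s)) a" using a
      by (simp add: pderiv_mult pcompose_add pcompose_mult)
    also have "pderiv (f * s) = -1"
    proof -
      have "of_nat Q = (0 :: 'a)"
        using of_nat_card_degree_less[OF d, where 'a = 'a] unfolding Q_def by (simp add: of_nat_poly)
      thus ?thesis unfolding s[symmetric]
        by (simp add: pderiv_diff pderiv_power x_def pderiv_pCons one_pCons)
    qed
    finally show False using g by (simp add: pcompose_uminus irreducible_def)
  qed
  \<comment> \<open>The root \<open>a\<close> itself may be multiple modulo g^2. By Taylor, f(a + g)
    - f(a) is f'(a) g modulo g^2, which is nonzero there, so at least one of \<open>a\<close> and
    \<open>a + g\<close> is a simple root.\<close>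
  hence "\<not> g\<^sup>2 dvd pcompose (pderiv f) a * g"
    using d by (auto simp: power2_eq_square)
  moreover have "g\<^sup>2 dvd pcompose f (a + g) - (pcompose f a + pcompose (pderiv f) a * g)"
    by (rule pcompose_taylor_dvd)
  ultimately have "\<not> (g\<^sup>2 dvd pcompose f a \<and> g\<^sup>2 dvd pcompose f (a + g))"
  proof (intro notI, elim conjE)
    assume nd: "\<not> g\<^sup>2 dvd pcompose (pderiv f) a * g"
      and T: "g\<^sup>2 dvd pcompose f (a + g) - (pcompose f a + pcompose (pderiv f) a * g)"
      and "g\<^sup>2 dvd pcompose f a" "g\<^sup>2 dvd pcompose f (a + g)"
    hence "g\<^sup>2 dvd pcompose f (a + g) - pcompose f a
        - (pcompose f (a + g) - (pcompose f a + pcompose (pderiv f) a * g))"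
      by (meson dvd_diff)
    with nd show False by simp
  qed
  moreover have "g dvd pcompose f (a + g)"
  proof -
    have "g dvd pcompose f (a + g) - pcompose f a"
      using pcompose_dvd_diff[of "a + g" a f] by simp
    from dvd_add[OF this a] show ?thesis by simp
  qed
  ultimately show ?thesis using a by blast
qed

text \<open>Write f(a) = g w with \<open>g\<close> not dividing \<open>w\<close>. Composing f^j c
  with \<open>a\<close> gives g^j w^j c(a), so one more factor \<open>g\<close> must sit in c(a);
  were \<open>f\<close> not a divisor of \<open>c\<close>, composing a Bezout identity for
  \<open>f\<close> and \<open>c\<close> with \<open>a\<close> would make \<open>g\<close> a
  unit.\<close>

lemma power_dvd_pcompose_iff:
  fixes f g a p :: "'a :: field poly"
  assumes f: "irreducible f" and g: "irreducible g"
    and a: "g dvd pcompose f a" "\<not> g\<^sup>2 dvd pcompose f a"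
  shows "g ^ j dvd pcompose p a \<longleftrightarrow> f ^ j dvd p"
proof
  assume "f ^ j dvd p"
  then obtain c where "p = f ^ j * c" unfolding dvd_def by auto
  thus "g ^ j dvd pcompose p a" using a(1)
    by (simp add: pcompose_mult pcompose_power dvd_power_same)
next
  obtain w where w: "pcompose f a = g * w" using a(1) unfolding dvd_def by auto
  have pr: "prime_elem g" using prime_elem_if_irreducible_poly[OF g] .
  have gw: "\<not> g dvd w" using a(2) w by (auto simp: power2_eq_square)
  show "g ^ j dvd pcompose p a \<Longrightarrow> f ^ j dvd p"
  proof (induction j)
    case (Suc j)
    have "g ^ j dvd pcompose p a" using Suc.prems by (metis dvd_mult_right power_Suc)
    then obtain c where c: "p = f ^ j * c" using Suc.IH unfolding dvd_def by auto
    have "g ^ j * g dvd g ^ j * (w ^ j * pcompose c a)"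
      using Suc.prems by (simp add: c pcompose_mult pcompose_power w power_mult_distrib mult_ac)
    hence "g dvd w ^ j * pcompose c a" using g by (auto simp: irreducible_def)
    hence gc: "g dvd pcompose c a" using pr gw
      by (auto simp: prime_elem_dvd_mult_iff dest: prime_elem_dvd_power)
    have "f dvd c"
    proof (rule ccontr)
      assume "\<not> f dvd c"
      then obtain u v where "u * f + v * c = 1" using irreducible_bezout[OF f] by blast
      hence "pcompose u a * pcompose f a + pcompose v a * pcompose c a = 1"
        by (metis pcompose_1 pcompose_add pcompose_mult)
      hence "g dvd 1" using a(1) gc by (metis dvd_add dvd_mult)
      thus False using g by (simp add: irreducible_def)
    qed
    thus ?case by (simp add: c mult.commute mult_dvd_mono)
  qed simp
qed

section \<open>Chinese remaindering for distinct monic irreducible polynomials\<close>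

lemma monic_irreducible_dvd_imp_eq:
  fixes f g :: "'a :: field poly"
  assumes "irreducible f" "irreducible g" "lead_coeff f = 1" "lead_coeff g = 1" "f dvd g"
  shows "f = g"
proof -
  obtain c where c: "g = f * c" using assms(5) unfolding dvd_def by auto
  hence "c dvd 1" using assms(1,2) irreducibleD[OF assms(2) c] by (auto simp: irreducible_def)
  then obtain r where r: "c = [:r:]" by (metis degree_eq_zeroE is_unit_iff_degree not_is_unit_0)
  hence "lead_coeff g = lead_coeff f * r" using c by (simp add: lead_coeff_mult)
  thus ?thesis using assms r c by simp
qed

lemma irreducible_not_dvd_prod_power:
  fixes g :: "'a :: field poly"
  assumes "finite S" "irreducible g" "lead_coeff g = 1" "g \<notin> S"
    and "\<And>h. h \<in> S \<Longrightarrow> irreducible h \<and> lead_coeff h = 1"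
  shows "\<not> g dvd (\<Prod>h\<in>S. h ^ k h)"
proof
  have pr: "prime_elem g" using prime_elem_if_irreducible_poly[OF assms(2)] .
  assume "g dvd (\<Prod>h\<in>S. h ^ k h)"
  then obtain h where h: "h \<in> S" "g dvd h ^ k h" using prime_elem_dvd_prod[OF pr assms(1)] by auto
  hence "g dvd h" using pr by (auto dest: prime_elem_dvd_power)
  hence "g = h" using assms h by (intro monic_irreducible_dvd_imp_eq) auto
  thus False using h assms by auto
qed

lemma simultaneous_residues:
  fixes t :: "'a :: field poly \<Rightarrow> 'a poly"
  assumes "finite S" and "\<And>g. g \<in> S \<Longrightarrow> irreducible g \<and> lead_coeff g = 1"
  shows "\<exists>a. \<forall>g\<in>S. g ^ k dvd a - t g"
  using assms
proof (induction S)
  case (insert g S)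
  then obtain a where a: "\<And>h. h \<in> S \<Longrightarrow> h ^ k dvd a - t h" by auto
  define c where "c = (\<Prod>h\<in>S. h ^ k)"
  have g: "irreducible g" using insert by auto
  have "\<not> g dvd c" unfolding c_def
    using insert by (intro irreducible_not_dvd_prod_power) auto
  then obtain u v where uv: "u * g ^ k + v * c = 1" using irreducible_power_bezout[OF g] by blast
  \<comment> \<open>The factor \<open>v * c\<close> is 1 modulo g^k and 0 modulo h^k for the
    \<open>h\<close> already treated, so the correction changes \<open>a\<close> only modulo
    g^k.\<close>
  define b where "b = a + (t g - a) * (v * c)"
  have "b - t g = (a - t g) * (u * g ^ k + v * c) - (a - t g) * (v * c)"
    unfolding uv b_def by (simp add: algebra_simps)
  hence "b - t g = (a - t g) * u * g ^ k" by (simp add: algebra_simps)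
  hence "g ^ k dvd b - t g" by simp
  moreover have "h ^ k dvd b - t h" if h: "h \<in> S" for h
  proof -
    have "h ^ k dvd c" unfolding c_def using h insert.hyps by auto
    hence "h ^ k dvd (a - t h) + (t g - a) * (v * c)" using a[OF h] by (intro dvd_add dvd_mult)
    also have "(a - t h) + (t g - a) * (v * c) = b - t h" by (simp add: b_def)
    finally show ?thesis .
  qed
  ultimately show ?case by auto
qed simp

text \<open>Whether \<open>a\<close> is a simple root modulo \<open>g\<close> depends only on
  \<open>a\<close> modulo g^2, so roots chosen separately for each \<open>g\<close> are glued by
  remaindering with exponent 2.\<close>

lemma exists_simultaneous_simple_root:
  fixes \<sigma> :: "'a :: {field, finite} poly \<Rightarrow> 'a poly"
  assumes "finite S" and S: "\<And>g. g \<in> S \<Longrightarrow> irreducible g \<and> lead_coeff g = 1"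
    and \<sigma>: "\<And>g. g \<in> S \<Longrightarrow> irreducible (\<sigma> g) \<and> degree (\<sigma> g) = degree g"
  shows "\<exists>a. \<forall>g\<in>S. g dvd pcompose (\<sigma> g) a \<and> \<not> g\<^sup>2 dvd pcompose (\<sigma> g) a"
proof -
  have "\<forall>g\<in>S. \<exists>a. g dvd pcompose (\<sigma> g) a \<and> \<not> g\<^sup>2 dvd pcompose (\<sigma> g) a"
    using S \<sigma> exists_simple_root_mod by blast
  then obtain t where t: "\<And>g. g \<in> S \<Longrightarrow> g dvd pcompose (\<sigma> g) (t g) \<and> \<not> g\<^sup>2 dvd pcompose (\<sigma> g) (t g)"
    by metis
  obtain a where a: "\<And>g. g \<in> S \<Longrightarrow> g\<^sup>2 dvd a - t g" using simultaneous_residues[OF assms(1) S] by metis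
  have "g dvd pcompose (\<sigma> g) a \<and> \<not> g\<^sup>2 dvd pcompose (\<sigma> g) a" if g: "g \<in> S" for g
  proof -
    have 2: "g\<^sup>2 dvd pcompose (\<sigma> g) a - pcompose (\<sigma> g) (t g)"
      using a[OF g] pcompose_dvd_diff dvd_trans by blast
    hence 1: "g dvd pcompose (\<sigma> g) a - pcompose (\<sigma> g) (t g)"
      by (metis dvd_mult_left power2_eq_square)
    show ?thesis using t[OF g] dvd_add_right_iff[OF 1, of "pcompose (\<sigma> g) (t g)"] dvd_add_right_iff[OF 2, of "pcompose (\<sigma> g) (t g)"] by simp
  qed
  thus ?thesis by blast
qed

subsection \<open>The action of polynomials on vectors\<close>

text \<open>\<open>M ^\<^sub>m Suc k\<close> unfolds with the new factor on the right; Horner's rule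
  needs it on the left.\<close>

lemma pow_mat_Suc_mult_vec:
  fixes M :: "'a :: comm_ring_1 mat"
  assumes M: "M \<in> carrier_mat n n" and v: "v \<in> carrier_vec n"
  shows "(M ^\<^sub>m Suc k) *\<^sub>v v = M *\<^sub>v ((M ^\<^sub>m k) *\<^sub>v v)"
proof -
  have c: "M ^\<^sub>m k \<in> carrier_mat n n" for k using M by (rule pow_carrier_mat)
  have "M ^\<^sub>m k * M = M * M ^\<^sub>m k"
  proof (induction k)
    case (Suc k)
    have "M ^\<^sub>m Suc k * M = M * M ^\<^sub>m k * M" using Suc by simp
    also have "\<dots> = M * M ^\<^sub>m Suc k" using M c by (simp add: assoc_mult_mat[of _ n n _ n _ n])
    finally show ?case .
  qed (use M in simp)
  thus ?thesis using M v c by (simp add: assoc_mult_mat_vec[of _ n n _ n])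
qed

lemma smult_zero_vec_eq [simp]: "c \<cdot>\<^sub>v 0\<^sub>v n = (0\<^sub>v n :: 'a :: mult_zero vec)"
  by (rule eq_vecI) auto

lemma zero_smult_vec_eq [simp]: "v \<in> carrier_vec n \<Longrightarrow> 0 \<cdot>\<^sub>v v = (0\<^sub>v n :: 'a :: mult_zero vec)"
  by (rule eq_vecI) auto

lemma mult_mat_zero_vec_eq [simp]:
  "A \<in> carrier_mat m n \<Longrightarrow> A *\<^sub>v 0\<^sub>v n = (0\<^sub>v m :: 'a :: semiring_0 vec)"
  by (rule eq_vecI) (auto simp: scalar_prod_def)

lemma poly_act_carrier [simp]:
  assumes "M \<in> carrier_mat n n" "v \<in> carrier_vec n"
  shows "poly_act M p v \<in> carrier_vec n"
proof -
  have "(M ^\<^sub>m k) *\<^sub>v v \<in> carrier_vec n" for k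
    using assms by (intro mult_mat_vec_carrier[of _ n n] pow_carrier_mat)
  moreover have "dim_row M = n" using assms by auto
  ultimately show ?thesis unfolding poly_act_def by (auto intro!: finsum_vec_closed)
qed

text \<open>The free bound \<open>N\<close> matters because \<open>degree (pCons c p)\<close> falls
  short of \<open>Suc (degree p)\<close> when \<open>p = 0\<close>.\<close>

lemma poly_act_index:
  fixes M :: "'a :: field mat"
  assumes M: "M \<in> carrier_mat n n" and v: "v \<in> carrier_vec n" and "i < n" "degree p \<le> N"
  shows "poly_act M p v $ i = (\<Sum>k\<le>N. coeff p k * ((M ^\<^sub>m k) *\<^sub>v v) $ i)"
proof -
  have c: "(M ^\<^sub>m k) *\<^sub>v v \<in> carrier_vec n" for k
    using M v by (intro mult_mat_vec_carrier[of _ n n] pow_carrier_mat)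
  have "dim_row M = n" using M by auto
  hence "poly_act M p v $ i = (\<Sum>k\<le>degree p. (coeff p k \<cdot>\<^sub>v ((M ^\<^sub>m k) *\<^sub>v v)) $ i)"
    unfolding poly_act_def using assms(3) c by (simp only:) (subst index_finsum_vec, auto)
  also have "\<dots> = (\<Sum>k\<le>degree p. coeff p k * ((M ^\<^sub>m k) *\<^sub>v v) $ i)"
    using carrier_vecD[OF c] assms(3) by (intro sum.cong) (auto simp del: index_mult_mat_vec)
  also have "\<dots> = (\<Sum>k\<le>N. coeff p k * ((M ^\<^sub>m k) *\<^sub>v v) $ i)"
    using assms(4) by (intro sum.mono_neutral_left) (auto simp: coeff_eq_0)
  finally show ?thesis .
qed

context
  fixes M :: "'a :: field mat" and n :: nat
  assumes M: "M \<in> carrier_mat n n"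
begin

lemma poly_act_0 [simp]:
  assumes v: "v \<in> carrier_vec n"
  shows "poly_act M 0 v = 0\<^sub>v n"
  by (rule eq_vecI) (use M v poly_act_carrier[OF M v, of 0] in \<open>auto simp: poly_act_index[OF M v, of _ 0 0]\<close>)

text \<open>Horner's rule. The module laws of the action follow from it by induction on polynomials,
  without reopening the defining sum.\<close>

lemma poly_act_pCons:
  assumes v: "v \<in> carrier_vec n"
  shows "poly_act M (pCons c p) v = c \<cdot>\<^sub>v v + M *\<^sub>v poly_act M p v"
proof (rule eq_vecI)
  have [simp]: "dim_vec (poly_act M q v) = n" for q using poly_act_carrier[OF M v, of q] by simp
  have [simp]: "dim_row M = n" "dim_col M = n" "dim_vec v = n" using M v by auto
  have Mk: "(M ^\<^sub>m k) *\<^sub>v v \<in> carrier_vec n" for k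
    using M v by (intro mult_mat_vec_carrier[of _ n n] pow_carrier_mat)
  show "dim_vec (poly_act M (pCons c p) v) = dim_vec (c \<cdot>\<^sub>v v + M *\<^sub>v poly_act M p v)" by simp
  fix i assume "i < dim_vec (c \<cdot>\<^sub>v v + M *\<^sub>v poly_act M p v)"
  hence i: "i < n" by simp
  have "degree (pCons c p) \<le> Suc (degree p)" by (rule degree_pCons_le)
  hence "poly_act M (pCons c p) v $ i
      = (\<Sum>k\<le>Suc (degree p). coeff (pCons c p) k * ((M ^\<^sub>m k) *\<^sub>v v) $ i)"
    by (rule poly_act_index[OF M v i])
  also have "\<dots> = c * v $ i + (\<Sum>k\<le>degree p. coeff p k * (M *\<^sub>v ((M ^\<^sub>m k) *\<^sub>v v)) $ i)"
    using M v by (subst sum.atMost_Suc_shift) (simp add: pow_mat_Suc_mult_vec[OF M v] del: pow_mat.simps(2))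
  also have "(\<Sum>k\<le>degree p. coeff p k * (M *\<^sub>v ((M ^\<^sub>m k) *\<^sub>v v)) $ i)
      = (\<Sum>k\<le>degree p. \<Sum>j<n. M $$ (i, j) * (coeff p k * ((M ^\<^sub>m k) *\<^sub>v v) $ j))"
  proof (rule sum.cong[OF refl])
    fix k
    have "dim_vec ((M ^\<^sub>m k) *\<^sub>v v) = n" using Mk[of k] by simp
    thus "coeff p k * (M *\<^sub>v ((M ^\<^sub>m k) *\<^sub>v v)) $ i
      = (\<Sum>j<n. M $$ (i, j) * (coeff p k * ((M ^\<^sub>m k) *\<^sub>v v) $ j))"
      using i by (simp add: scalar_prod_def sum_distrib_left mult_ac lessThan_atLeast0)
  qed
  also have "\<dots> = (\<Sum>j<n. M $$ (i, j) * poly_act M p v $ j)"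
    by (subst sum.swap) (simp add: sum_distrib_left poly_act_index[OF M v _ order.refl])
  also have "\<dots> = (M *\<^sub>v poly_act M p v) $ i"
    using i by (simp add: scalar_prod_def lessThan_atLeast0)
  finally show "poly_act M (pCons c p) v $ i = (c \<cdot>\<^sub>v v + M *\<^sub>v poly_act M p v) $ i"
    using i by simp
qed

lemma poly_act_add_left:
  assumes v: "v \<in> carrier_vec n"
  shows "poly_act M (p + q) v = poly_act M p v + poly_act M q v"
proof (induction p q rule: poly_induct2)
  case 0
  show ?case using v by simp
next
  case (pCons c p d q)
  have cr: "poly_act M r v \<in> carrier_vec n" "M *\<^sub>v poly_act M r v \<in> carrier_vec n" for r
    using M v by auto
  show ?case using v cr M
    by (simp add: poly_act_pCons pCons mult_add_distrib_mat_vec[OF M] add_smult_distrib_vec)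
       (rule eq_vecI, auto simp: algebra_simps)
qed

lemma poly_act_smult:
  assumes v: "v \<in> carrier_vec n"
  shows "poly_act M (Polynomial.smult c p) v = c \<cdot>\<^sub>v poly_act M p v"
proof (induction p)
  case 0
  show ?case using v by simp
next
  case (pCons d p)
  have "poly_act M p v \<in> carrier_vec n" "M *\<^sub>v poly_act M p v \<in> carrier_vec n"
    using M v by auto
  thus ?case using v
    by (simp add: poly_act_pCons pCons mult_mat_vec[OF M] smult_add_distrib_vec[of _ n] smult_smult_assoc)
qed

lemma poly_act_1 [simp]:
  assumes v: "v \<in> carrier_vec n"
  shows "poly_act M 1 v = v"
  using v M by (simp add: one_pCons poly_act_pCons)

lemma poly_act_mult:
  assumes v: "v \<in> carrier_vec n"
  shows "poly_act M (p * q) v = poly_act M p (poly_act M q v)"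
proof (induction p)
  case 0
  show ?case using v M by simp
next
  case (pCons c p)
  show ?case using v M by (simp add: poly_act_add_left poly_act_smult poly_act_pCons pCons)
qed

lemma poly_act_add_right:
  assumes v: "v \<in> carrier_vec n" and w: "w \<in> carrier_vec n"
  shows "poly_act M p (v + w) = poly_act M p v + poly_act M p w"
proof (induction p)
  case 0
  show ?case using v w by simp
next
  case (pCons c p)
  have "poly_act M p v \<in> carrier_vec n" "poly_act M p w \<in> carrier_vec n"
    "M *\<^sub>v poly_act M p v \<in> carrier_vec n" "M *\<^sub>v poly_act M p w \<in> carrier_vec n"
    using M v w by auto
  thus ?case using v w
    by (simp add: poly_act_pCons pCons mult_add_distrib_mat_vec[OF M] smult_add_distrib_vec[of _ n])
       (rule eq_vecI, auto simp: algebra_simps)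
qed

lemma poly_act_zero_vec [simp]: "poly_act M p (0\<^sub>v n) = 0\<^sub>v n"
proof (induction p)
  case (pCons c p)
  thus ?case using M by (simp add: poly_act_pCons)
qed simp

lemma poly_act_X:
  assumes v: "v \<in> carrier_vec n"
  shows "poly_act M [:0, 1:] v = M *\<^sub>v v"
proof -
  have "M *\<^sub>v v \<in> carrier_vec n" using M v by simp
  thus ?thesis using v M by (simp add: poly_act_pCons mult_mat_vec[OF M] poly_act_1[unfolded one_pCons])
qed

text \<open>The inclusion of Cent M in Cent p(M), expressed on vectors without forming the matrix
  p(M).\<close>

lemma poly_act_commute:
  assumes v: "v \<in> carrier_vec n" and A: "A \<in> carrier_mat n n" and AM: "A * M = M * A"
  shows "poly_act M p (A *\<^sub>v v) = A *\<^sub>v poly_act M p v"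
proof (induction p)
  case 0
  show ?case using A v by simp
next
  case (pCons c p)
  have c: "poly_act M p v \<in> carrier_vec n" "M *\<^sub>v poly_act M p v \<in> carrier_vec n"
    using M v by auto
  have "M *\<^sub>v (A *\<^sub>v poly_act M p v) = A *\<^sub>v (M *\<^sub>v poly_act M p v)"
    using assoc_mult_mat_vec[OF M A c(1)] assoc_mult_mat_vec[OF A M c(1)] AM by simp
  thus ?case using c v A
    by (simp add: poly_act_pCons pCons mult_add_distrib_mat_vec[OF A] mult_mat_vec[OF A])
qed

lemma poly_act_finsum_right:
  assumes "finite S" "\<And>s. s \<in> S \<Longrightarrow> w s \<in> carrier_vec n"
  shows "poly_act M p (finsum_vec TYPE('a) n w S) = finsum_vec TYPE('a) n (\<lambda>s. poly_act M p (w s)) S"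
  using assms
proof (induction S)
  case empty
  show ?case by (simp add: finsum_vec_empty)
next
  case (insert s S)
  have "w \<in> S \<rightarrow> carrier_vec n" "(\<lambda>s. poly_act M p (w s)) \<in> S \<rightarrow> carrier_vec n"
    "w s \<in> carrier_vec n" "poly_act M p (w s) \<in> carrier_vec n"
    using insert.prems M by auto
  thus ?case using insert
    by (simp add: finsum_vec_insert finsum_vec_closed poly_act_add_right)
qed

lemma poly_act_finsum_left:
  assumes "finite S" and v: "v \<in> carrier_vec n"
  shows "poly_act M (\<Sum>s\<in>S. p s) v = finsum_vec TYPE('a) n (\<lambda>s. poly_act M (p s) v) S"
  using assms(1)
proof (induction S)
  case empty
  show ?case using v by (simp add: finsum_vec_empty)
next
  case (insert s S)
  have "(\<lambda>s. poly_act M (p s) v) \<in> S \<rightarrow> carrier_vec n" using M v by auto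
  thus ?case using insert v M
    by (simp add: finsum_vec_insert poly_act_add_left)
qed

end

subsection \<open>Primary decomposition\<close>

lemma finsum_vec_index:
  fixes w :: "'i \<Rightarrow> 'a :: comm_monoid_add vec"
  assumes "finite S" "i < n" "\<And>s. s \<in> S \<Longrightarrow> w s \<in> carrier_vec n"
  shows "finsum_vec TYPE('a) n w S $ i = (\<Sum>s\<in>S. w s $ i)"
  using assms by (intro index_finsum_vec) auto

lemma finsum_vec_carrier [simp]:
  fixes w :: "'i \<Rightarrow> 'a :: comm_monoid_add vec"
  assumes "\<And>s. s \<in> S \<Longrightarrow> w s \<in> carrier_vec n"
  shows "finsum_vec TYPE('a) n w S \<in> carrier_vec n"
  using assms by (intro finsum_vec_closed) auto

lemma finsum_vec_zero:
  fixes w :: "'i \<Rightarrow> 'a :: comm_monoid_add vec"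
  assumes "finite S" "\<And>s. s \<in> S \<Longrightarrow> w s = 0\<^sub>v n"
  shows "finsum_vec TYPE('a) n w S = 0\<^sub>v n"
proof (rule eq_vecI)
  have c: "w s \<in> carrier_vec n" if "s \<in> S" for s using assms(2)[OF that] by simp
  thus "dim_vec (finsum_vec TYPE('a) n w S) = dim_vec (0\<^sub>v n :: 'a vec)"
    using finsum_vec_carrier[of S w n] by simp
  fix i assume "i < dim_vec (0\<^sub>v n :: 'a vec)"
  thus "finsum_vec TYPE('a) n w S $ i = 0\<^sub>v n $ i"
    using assms c by (simp add: finsum_vec_index)
qed

lemma finsum_vec_unit_expansion:
  fixes v :: "'a :: comm_ring_1 vec"
  assumes "v \<in> carrier_vec n"
  shows "v = finsum_vec TYPE('a) n (\<lambda>j. v $ j \<cdot>\<^sub>v unit_vec n j) {..<n}" (is "v = ?s")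
proof (rule eq_vecI)
  have s: "?s \<in> carrier_vec n" by simp
  show "dim_vec v = dim_vec ?s" by (simp only: carrier_vecD[OF s] carrier_vecD[OF assms])
  fix i assume "i < dim_vec ?s"
  hence i: "i < n" using carrier_vecD[OF s] by simp
  have "?s $ i = (\<Sum>j<n. (v $ j \<cdot>\<^sub>v unit_vec n j) $ i)"
    by (rule finsum_vec_index) (use i in auto)
  also have "\<dots> = (\<Sum>j<n. if i = j then v $ j else 0)"
    using i by (intro sum.cong) auto
  finally have "?s $ i = (\<Sum>j<n. if i = j then v $ j else 0)" .
  thus "v $ i = ?s $ i" using i by simp
qed

lemma poly_act_const:
  assumes "M \<in> carrier_mat n n" "v \<in> carrier_vec n"
  shows "poly_act M [:c:] v = c \<cdot>\<^sub>v v"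
  using poly_act_smult[OF assms, of c 1] poly_act_1[OF assms] by simp

lemma poly_act_smult_right:
  assumes M: "M \<in> carrier_mat n n" and v: "v \<in> carrier_vec n"
  shows "poly_act M p (c \<cdot>\<^sub>v v) = c \<cdot>\<^sub>v poly_act M p v"
proof -
  have "poly_act M p (c \<cdot>\<^sub>v v) = poly_act M (p * [:c:]) v"
    by (simp only: poly_act_mult[OF M v] poly_act_const[OF M v])
  also have "p * [:c:] = Polynomial.smult c p" by simp
  finally show ?thesis by (simp only: poly_act_smult[OF M v])
qed

text \<open>The determinant trick: the unit vectors satisfy a square system of linear relations over
  K[x], and multiplying by the adjugate shows that its determinant, the characteristic polynomial,
  kills each of them. It supplies the nonzero annihilator with which the primary decomposition
  starts.\<close>

lemma cayley_hamilton:
  fixes M :: "'a :: field mat"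
  assumes M: "M \<in> carrier_mat n n" and v: "v \<in> carrier_vec n"
  shows "poly_act M (char_poly M) v = 0\<^sub>v n"
proof -
  \<comment> \<open>Transposing makes row \<open>i\<close> of \<open>C\<close> the relation saying
    that x e_i equals the combination of the e_j with coefficients
    \<open>M $$ (j, i)\<close>.\<close>
  define C where "C = transpose_mat (char_poly_matrix M)"
  have C: "C \<in> carrier_mat n n" unfolding C_def using M by simp
  define D where "D = adj_mat C"
  have D: "D \<in> carrier_mat n n" and DC: "D * C = det C \<cdot>\<^sub>m 1\<^sub>m n"
    unfolding D_def using adj_mat[OF C] by auto
  have det: "det C = char_poly M"
    unfolding C_def char_poly_def by (rule det_transpose[OF char_poly_matrix_closed[OF M]])
  define e where "e j = (unit_vec n j :: 'a vec)" for j
  have e [simp]: "e j \<in> carrier_vec n" for j unfolding e_def by simp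
  have de [simp]: "dim_vec (e j) = n" for j unfolding e_def by simp
  have pc [simp]: "poly_act M p (e j) \<in> carrier_vec n" for p j using M by simp
  have e_index: "e j $ k = (if k = j then 1 else 0)" if "k < n" for j k
    using that by (simp add: e_def unit_vec_def)
  have Me_index: "(M *\<^sub>v e j) $ k = M $$ (k, j)" if "k < n" "j < n" for j k
    using that M by (auto simp: e_def)
  have Cij: "poly_act M (C $$ (i, j)) (e j) = (if i = j then M *\<^sub>v e j else 0\<^sub>v n) + (- (M $$ (j, i))) \<cdot>\<^sub>v e j"
    if "i < n" "j < n" for i j
  proof -
    have "C $$ (i, j) = (if i = j then [:0, 1:] else 0) + [:- (M $$ (j, i)):]"
      using that M unfolding C_def char_poly_matrix_def by auto
    thus ?thesis using M
      by (simp only: poly_act_add_left[OF M e] poly_act_const[OF M e] poly_act_X[OF M e] poly_act_0[OF M e]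
          if_distrib[of "\<lambda>p. poly_act M p _"] cong: if_cong)
  qed
  have row0: "finsum_vec TYPE('a) n (\<lambda>j. poly_act M (C $$ (i, j)) (e j)) {..<n} = 0\<^sub>v n" (is "?s = _")
    if i: "i < n" for i
  proof (rule eq_vecI)
    have s: "?s \<in> carrier_vec n" by simp
    show "dim_vec ?s = dim_vec (0\<^sub>v n :: 'a vec)" using carrier_vecD[OF s] by simp
    fix k assume "k < dim_vec (0\<^sub>v n :: 'a vec)"
    hence k: "k < n" by simp
    have "?s $ k = (\<Sum>j<n. poly_act M (C $$ (i, j)) (e j) $ k)"
      using k by (subst finsum_vec_index) auto
    also have "\<dots> = (\<Sum>j<n. (if i = j then M $$ (k, j) else 0) - (if k = j then M $$ (j, i) else 0))"
      using i k M by (intro sum.cong) (auto simp: Cij e_index Me_index simp del: index_mult_mat_vec)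
    also have "\<dots> = 0" using i k by (simp add: sum_subtractf)
    finally show "?s $ k = 0\<^sub>v n $ k" using k by simp
  qed
  have unit: "poly_act M (char_poly M) (e k) = 0\<^sub>v n" if k: "k < n" for k
  proof (rule eq_vecI)
    show "dim_vec (poly_act M (char_poly M) (e k)) = dim_vec (0\<^sub>v n :: 'a vec)"
      by (simp only: carrier_vecD[OF pc] index_zero_vec(2))
    fix l assume "l < dim_vec (0\<^sub>v n :: 'a vec)"
    hence l: "l < n" by simp
    \<comment> \<open>Weighting the relations by row \<open>k\<close> of the adjugate leaves only
      e_k, with coefficient \<open>char_poly M\<close>.\<close>
    have DCkj: "(\<Sum>i<n. D $$ (k, i) * C $$ (i, j)) = (if k = j then char_poly M else 0)" if j: "j < n" for j
    proof -
      have "(\<Sum>i<n. D $$ (k, i) * C $$ (i, j)) = (D * C) $$ (k, j)"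
        using C D k j by (simp add: scalar_prod_def lessThan_atLeast0)
      thus ?thesis using j k det unfolding DC by simp
    qed
    have "poly_act M (char_poly M) (e k) $ l
        = (\<Sum>j<n. if k = j then poly_act M (char_poly M) (e j) $ l else 0)"
      using k by simp
    also have "\<dots> = (\<Sum>j<n. poly_act M (\<Sum>i<n. D $$ (k, i) * C $$ (i, j)) (e j) $ l)"
      using M l by (intro sum.cong) (auto simp: DCkj)
    also have "\<dots> = (\<Sum>j<n. \<Sum>i<n. poly_act M (D $$ (k, i)) (poly_act M (C $$ (i, j)) (e j)) $ l)"
      using l M by (intro sum.cong[OF refl], subst poly_act_finsum_left[OF M])
        (auto simp: finsum_vec_index poly_act_mult[OF M])
    also have "\<dots> = (\<Sum>i<n. \<Sum>j<n. poly_act M (D $$ (k, i)) (poly_act M (C $$ (i, j)) (e j)) $ l)"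
      by (rule sum.swap)
    also have "\<dots> = (\<Sum>i<n. poly_act M (D $$ (k, i)) (finsum_vec TYPE('a) n (\<lambda>j. poly_act M (C $$ (i, j)) (e j)) {..<n}) $ l)"
      using l M by (intro sum.cong[OF refl], subst poly_act_finsum_right[OF M]) (auto simp: finsum_vec_index)
    also have "\<dots> = 0" using row0 l M by simp
    finally show "poly_act M (char_poly M) (e k) $ l = 0\<^sub>v n $ l" using l by simp
  qed
  have "poly_act M (char_poly M) (v $ j \<cdot>\<^sub>v e j) = 0\<^sub>v n" if "j < n" for j
    using unit[OF that] by (simp add: poly_act_smult_right[OF M])
  hence "finsum_vec TYPE('a) n (\<lambda>j. poly_act M (char_poly M) (v $ j \<cdot>\<^sub>v e j)) {..<n} = 0\<^sub>v n"
    by (intro finsum_vec_zero) auto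
  hence "poly_act M (char_poly M) (finsum_vec TYPE('a) n (\<lambda>j. v $ j \<cdot>\<^sub>v e j) {..<n}) = 0\<^sub>v n"
    by (simp add: poly_act_finsum_right[OF M])
  thus ?thesis by (simp only: finsum_vec_unit_expansion[OF v, folded e_def, symmetric])
qed

text \<open>For \<open>M\<close> of size \<open>n\<close> this is the carrier of
  \<open>primary_component (matrix_module M) class_ring f\<close>, as a plain set of
  vectors.\<close>

definition primary_vecs :: "nat \<Rightarrow> 'a :: field mat \<Rightarrow> 'a poly \<Rightarrow> 'a vec set" where
  "primary_vecs n M f = {v \<in> carrier_vec n. \<exists>k. poly_act M (f ^ k) v = 0\<^sub>v n}"

lemma primary_vecs_add:
  assumes M: "M \<in> carrier_mat n n" and "v \<in> primary_vecs n M f" "w \<in> primary_vecs n M f"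
  shows "v + w \<in> primary_vecs n M f"
proof -
  obtain k l where v: "v \<in> carrier_vec n" "poly_act M (f ^ k) v = 0\<^sub>v n"
    and w: "w \<in> carrier_vec n" "poly_act M (f ^ l) w = 0\<^sub>v n"
    using assms unfolding primary_vecs_def by auto
  have "poly_act M (f ^ l * f ^ k) v = 0\<^sub>v n" "poly_act M (f ^ k * f ^ l) w = 0\<^sub>v n"
    using v w M by (simp_all add: poly_act_mult)
  hence "poly_act M (f ^ (k + l)) (v + w) = 0\<^sub>v n"
    using v w M by (simp add: poly_act_add_right power_add mult.commute)
  thus ?thesis using v w unfolding primary_vecs_def by auto
qed

text \<open>A divisor of least positive degree is irreducible; scaling makes it monic.\<close>

lemma exists_monic_irreducible_dvd:
  fixes c :: "'a :: field poly"
  assumes "0 < degree c"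
  shows "\<exists>f. irreducible f \<and> lead_coeff f = 1 \<and> f dvd c"
proof -
  define P where "P f \<longleftrightarrow> 0 < degree f \<and> f dvd c" for f
  have "P c" using assms by (simp add: P_def)
  then obtain f where f: "P f" and min: "\<And>g. P g \<Longrightarrow> degree f \<le> degree g"
    using ex_has_least_nat[of P c degree] by auto
  have f0: "f \<noteq> 0" using f by (auto simp: P_def)
  have irr: "irreducible f"
  proof (rule irreducibleI)
    show "f \<noteq> 0" by fact
    show "\<not> f dvd 1" using f f0 by (simp add: P_def is_unit_iff_degree)
    fix a b assume ab: "f = a * b"
    have nz: "a \<noteq> 0" "b \<noteq> 0" using ab f0 by auto
    hence deg: "degree f = degree a + degree b" using ab by (simp add: degree_mult_eq)
    have "a dvd c" using f ab by (auto simp: P_def dest: dvd_mult_left)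
    hence "degree a = 0 \<or> degree f \<le> degree a" using min[of a] by (auto simp: P_def)
    thus "a dvd 1 \<or> b dvd 1" using deg nz by (auto simp: is_unit_iff_degree)
  qed
  define g where "g = Polynomial.smult (inverse (lead_coeff f)) f"
  have l: "inverse (lead_coeff f) \<noteq> 0" using f0 by simp
  have 1: "lead_coeff g = 1" using f0 by (simp add: g_def)
  have 2: "g dvd c" using f l by (simp add: g_def P_def smult_dvd_iff)
  have "g = [:inverse (lead_coeff f):] * f" by (simp add: g_def)
  moreover have "[:inverse (lead_coeff f):] dvd 1" using l by (simp add: is_unit_iff_degree)
  ultimately have "irreducible g" using irr by (simp only: irreducible_mult_unit_left)
  thus ?thesis using 1 2 by blast
qed

lemma exists_power_cofactor:
  fixes c f :: "'a :: idom poly"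
  assumes "c \<noteq> 0" "0 < degree f"
  shows "\<exists>k c'. c = f ^ k * c' \<and> \<not> f dvd c'"
  using assms(1)
proof (induction "degree c" arbitrary: c rule: less_induct)
  case less
  show ?case
  proof (cases "f dvd c")
    case True
    then obtain d where d: "c = f * d" unfolding dvd_def by auto
    hence d0: "d \<noteq> 0" using less.prems by auto
    have "f \<noteq> 0" using assms(2) by auto
    hence "degree d < degree c" using d d0 assms(2) by (simp add: degree_mult_eq)
    from less.hyps[OF this d0] obtain k c' where "d = f ^ k * c'" "\<not> f dvd c'" by blast
    hence "c = f ^ Suc k * c' \<and> \<not> f dvd c'" using d by simp
    thus ?thesis by blast
  next
    case False
    thus ?thesis by (intro exI[of _ 0] exI[of _ c]) simp
  qed
qed

text \<open>Induction on the degree of an annihilator \<open>c\<close> of the single vector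
  \<open>v\<close>. Writing c = f^k c' with \<open>f\<close> not dividing \<open>c'\<close>, a
  Bezout identity splits \<open>v\<close> into a part killed by f^k and a part killed by
  \<open>c'\<close>, which has smaller degree.\<close>

lemma primary_decomposition:
  fixes M :: "'a :: field mat"
  assumes M: "M \<in> carrier_mat n n" and S: "finite S"
    and "c \<noteq> 0" "v \<in> carrier_vec n" "poly_act M c v = 0\<^sub>v n"
    and "\<And>f. irreducible f \<Longrightarrow> lead_coeff f = 1 \<Longrightarrow> f dvd c \<Longrightarrow> f \<in> S"
  shows "\<exists>w. (\<forall>f\<in>S. w f \<in> primary_vecs n M f) \<and> v = finsum_vec TYPE('a) n w S"
  using assms(3-)
proof (induction "degree c" arbitrary: c v rule: less_induct)
  case less
  note v = less.prems(2)
  show ?case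
  proof (cases "degree c = 0")
    case True
    then obtain r where r: "c = [:r:]" by (auto elim: degree_eq_zeroE)
    hence "r \<noteq> 0" using less.prems by auto
    have "v = poly_act M ([:inverse r:] * c) v" using \<open>r \<noteq> 0\<close> M v by (simp add: r poly_act_1 flip: one_pCons)
    also have "\<dots> = 0\<^sub>v n" by (simp only: poly_act_mult[OF M v] less.prems(3) poly_act_zero_vec[OF M])
    finally have "v = 0\<^sub>v n" .
    moreover have "finsum_vec TYPE('a) n (\<lambda>_. 0\<^sub>v n) S = 0\<^sub>v n" using S by (intro finsum_vec_zero) auto
    moreover have "0\<^sub>v n \<in> primary_vecs n M f" for f using M by (simp add: primary_vecs_def)
    ultimately show ?thesis by (intro exI[of _ "\<lambda>_. 0\<^sub>v n"]) auto
  next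
    case False
    then obtain f where f: "irreducible f" "lead_coeff f = 1" "f dvd c"
      using exists_monic_irreducible_dvd by blast
    have fS: "f \<in> S" using less.prems(4) f by blast
    obtain k c' where c': "c = f ^ k * c'" "\<not> f dvd c'"
      using exists_power_cofactor[OF less.prems(1) irreducible_degree_pos[OF f(1)]] by blast
    obtain u t where ut: "u * f ^ k + t * c' = 1" using irreducible_power_bezout[OF f(1) c'(2)] by blast
    define v0 where "v0 = poly_act M (t * c') v"
    define v1 where "v1 = poly_act M (u * f ^ k) v"
    have vc: "v0 \<in> carrier_vec n" "v1 \<in> carrier_vec n" unfolding v0_def v1_def using M v by auto
    have v01: "v = v1 + v0"
      unfolding v0_def v1_def poly_act_add_left[OF M v, symmetric] ut using M v by simp
    have "poly_act M (f ^ k) v0 = poly_act M (t * c) v"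
      unfolding v0_def poly_act_mult[OF M v, symmetric] c'(1) by (simp add: mult_ac)
    also have "\<dots> = 0\<^sub>v n" using less.prems(3) v M by (simp add: poly_act_mult)
    finally have v0V: "v0 \<in> primary_vecs n M f" using vc by (auto simp: primary_vecs_def)
    have "poly_act M c' v1 = poly_act M (u * c) v"
      unfolding v1_def poly_act_mult[OF M v, symmetric] c'(1) by (simp add: mult_ac)
    also have "\<dots> = 0\<^sub>v n" using less.prems(3) v M by (simp add: poly_act_mult)
    finally have v1: "poly_act M c' v1 = 0\<^sub>v n" .
    have c'0: "c' \<noteq> 0" using c'(1) less.prems(1) by auto
    have "k \<noteq> 0" using c' f(3) by (intro notI) simp
    hence "degree c' < degree c" using c'0 f(1) irreducible_degree_pos[OF f(1)] unfolding c'(1)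
      by (simp add: degree_mult_eq degree_power_eq irreducible_def)
    from less.hyps[OF this c'0 vc(2) v1]
    obtain w where w: "\<And>g. g \<in> S \<Longrightarrow> w g \<in> primary_vecs n M g" and v1w: "v1 = finsum_vec TYPE('a) n w S"
      using less.prems(4) c'(1) by (metis dvd_mult)
    \<comment> \<open>The induction hypothesis still provides a component at \<open>f\<close>, so
      \<open>v0\<close> is added to it rather than replacing it.\<close>
    define w' where "w' = (\<lambda>g. if g = f then w g + v0 else w g)"
    have w': "w' g \<in> primary_vecs n M g" if "g \<in> S" for g
      using w[OF that] v0V M by (auto simp: w'_def intro: primary_vecs_add)
    have wc: "w g \<in> carrier_vec n" "w' g \<in> carrier_vec n" if "g \<in> S" for g
      using w[OF that] w'[OF that] by (auto simp: primary_vecs_def)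
    have "v = finsum_vec TYPE('a) n w' S"
    proof (rule eq_vecI)
      have s: "finsum_vec TYPE('a) n w' S \<in> carrier_vec n" using wc by simp
      show "dim_vec v = dim_vec (finsum_vec TYPE('a) n w' S)" using carrier_vecD[OF s] carrier_vecD[OF v] by simp
      fix i assume "i < dim_vec (finsum_vec TYPE('a) n w' S)"
      hence i: "i < n" using carrier_vecD[OF s] by simp
      have "finsum_vec TYPE('a) n w' S $ i = (\<Sum>g\<in>S. w' g $ i)"
        using S i wc by (intro finsum_vec_index)
      also have "\<dots> = (\<Sum>g\<in>S. w g $ i + (if g = f then v0 $ i else 0))"
        using i wc vc by (intro sum.cong) (auto simp: w'_def)
      also have "\<dots> = finsum_vec TYPE('a) n w S $ i + v0 $ i"
        using S i wc fS by (simp add: finsum_vec_index sum.distrib)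
      also have "\<dots> = v $ i" unfolding v1w[symmetric] v01 using i vc by simp
      finally show "v $ i = finsum_vec TYPE('a) n w' S $ i" by simp
    qed
    thus ?thesis using w' by blast
  qed
qed

text \<open>The product of annihilators of the other components turns the relation into one for
  \<open>w f\<close> alone. This product is coprime to \<open>f\<close>, while a power of
  \<open>f\<close> also kills \<open>w f\<close>.\<close>

lemma primary_independent:
  fixes M :: "'a :: field mat"
  assumes M: "M \<in> carrier_mat n n" and S: "finite S"
    and irr: "\<And>f. f \<in> S \<Longrightarrow> irreducible f \<and> lead_coeff f = 1"
    and w: "\<And>f. f \<in> S \<Longrightarrow> w f \<in> primary_vecs n M f"
    and 0: "finsum_vec TYPE('a) n w S = 0\<^sub>v n" and f: "f \<in> S"
  shows "w f = 0\<^sub>v n"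
proof -
  have "\<forall>h\<in>S. \<exists>k. poly_act M (h ^ k) (w h) = 0\<^sub>v n" using w by (auto simp: primary_vecs_def)
  then obtain k where k: "\<And>h. h \<in> S \<Longrightarrow> poly_act M (h ^ k h) (w h) = 0\<^sub>v n" by metis
  have wc: "w h \<in> carrier_vec n" if "h \<in> S" for h using w[OF that] by (auto simp: primary_vecs_def)
  define c where "c = (\<Prod>h\<in>S - {f}. h ^ k h)"
  have ch: "poly_act M c (w h) = 0\<^sub>v n" if h: "h \<in> S" "h \<noteq> f" for h
  proof -
    have "h ^ k h dvd c" unfolding c_def using h S by (intro dvd_prodI) auto
    then obtain d where "c = d * h ^ k h" unfolding dvd_def by (auto simp: mult.commute)
    thus ?thesis using k[OF h(1)] wc[OF h(1)] M by (simp add: poly_act_mult)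
  qed
  have "poly_act M c (w f) = 0\<^sub>v n"
  proof (rule eq_vecI)
    show "dim_vec (poly_act M c (w f)) = dim_vec (0\<^sub>v n :: 'a vec)"
      using poly_act_carrier[OF M wc[OF f], of c] by simp
    fix i assume "i < dim_vec (0\<^sub>v n :: 'a vec)"
    hence i: "i < n" by simp
    have "poly_act M c (w f) $ i = (\<Sum>h\<in>S. if h = f then poly_act M c (w f) $ i else 0)"
      using S f by simp
    also have "\<dots> = (\<Sum>h\<in>S. poly_act M c (w h) $ i)"
      using i by (intro sum.cong) (auto simp: ch)
    also have "\<dots> = finsum_vec TYPE('a) n (\<lambda>h. poly_act M c (w h)) S $ i"
      using S i wc M by (simp add: finsum_vec_index)
    also have "\<dots> = poly_act M c (finsum_vec TYPE('a) n w S) $ i"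
      using S wc by (simp add: poly_act_finsum_right[OF M])
    also have "\<dots> = 0\<^sub>v n $ i" unfolding 0 using M by simp
    finally show "poly_act M c (w f) $ i = 0\<^sub>v n $ i" .
  qed
  moreover have "\<not> f dvd c" unfolding c_def
    using S irr f by (intro irreducible_not_dvd_prod_power) auto
  then obtain u t where "u * f ^ k f + t * c = 1" using irreducible_power_bezout irr[OF f] by blast
  hence "w f = poly_act M (u * f ^ k f + t * c) (w f)" using wc[OF f] M by simp
  ultimately show ?thesis using k[OF f] wc[OF f] M by (simp add: poly_act_mult poly_act_add_left)
qed

subsection \<open>Presentations of matrix modules\<close>

lemma cgenideal_coset:
  fixes g a :: "'a :: comm_ring_1"
  shows "PIdl\<^bsub>class_ring\<^esub> g +>\<^bsub>class_ring\<^esub> a = {x. g dvd x - a}"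
proof -
  have "x \<in> PIdl\<^bsub>class_ring\<^esub> g +>\<^bsub>class_ring\<^esub> a \<longleftrightarrow> g dvd x - a" for x
  proof
    assume "x \<in> PIdl\<^bsub>class_ring\<^esub> g +>\<^bsub>class_ring\<^esub> a"
    thus "g dvd x - a" by (auto simp: a_r_coset_def' cgenideal_def)
  next
    assume "g dvd x - a"
    then obtain k where "x = k * g + a" unfolding dvd_def by (metis diff_add_cancel mult.commute)
    thus "x \<in> PIdl\<^bsub>class_ring\<^esub> g +>\<^bsub>class_ring\<^esub> a" by (auto simp: a_r_coset_def' cgenideal_def)
  qed
  thus ?thesis by blast
qed

context
  fixes g :: "'a :: field poly"
begin

lemma residue_class_eq_iff: "{x. g dvd x - a} = {x. g dvd x - b} \<longleftrightarrow> g dvd a - b"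
proof
  assume "{x. g dvd x - a} = {x. g dvd x - b}"
  moreover have "a \<in> {x. g dvd x - a}" by simp
  ultimately show "g dvd a - b" by blast
next
  assume 1: "g dvd a - b"
  have "g dvd x - a \<longleftrightarrow> g dvd x - b" for x
    using dvd_add[OF _ 1, of "x - a"] dvd_diff[OF _ 1, of "x - b"] by auto
  thus "{x. g dvd x - a} = {x. g dvd x - b}" by blast
qed

lemma poly_quotient_carrier: "carrier (poly_quotient g) = range (\<lambda>a. {x. g dvd x - a})"
  unfolding poly_quotient_def quotient_module_def FactRing_def A_RCOSETS_def' cgenideal_coset by auto

lemma poly_quotient_add:
  "{x. g dvd x - a} \<oplus>\<^bsub>poly_quotient g\<^esub> {x. g dvd x - b} = {x. g dvd x - (a + b)}"
proof -
  have "(\<exists>y z. g dvd y - a \<and> g dvd z - b \<and> x = y + z) \<longleftrightarrow> g dvd x - (a + b)" for x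
  proof
    assume "\<exists>y z. g dvd y - a \<and> g dvd z - b \<and> x = y + z"
    then obtain y z where yz: "g dvd y - a" "g dvd z - b" "x = y + z" by blast
    thus "g dvd x - (a + b)" using dvd_add[OF yz(1,2)] by (simp add: algebra_simps)
  next
    assume "g dvd x - (a + b)"
    thus "\<exists>y z. g dvd y - a \<and> g dvd z - b \<and> x = y + z"
      by (intro exI[of _ "x - b"] exI[of _ b]) (simp add: algebra_simps)
  qed
  thus ?thesis unfolding poly_quotient_def quotient_module_def FactRing_def
    by (auto simp: set_add_def')
qed

lemma poly_quotient_smult:
  "r \<odot>\<^bsub>poly_quotient g\<^esub> {x. g dvd x - a} = {x. g dvd x - r * a}"
proof -
  have cong: "g dvd y * z - r * a" if "g dvd y - r" "g dvd z - a" for y z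
  proof -
    have "y * z - r * a = (y - r) * z + r * (z - a)" by (simp add: algebra_simps)
    thus ?thesis using that by simp
  qed
  \<comment> \<open>The product of two cosets is a union over their representatives; all the cosets
    in this union coincide.\<close>
  have "r \<odot>\<^bsub>poly_quotient g\<^esub> {x. g dvd x - a}
      = (\<Union>y\<in>{x. g dvd x - r}. \<Union>z\<in>{x. g dvd x - a}. {x. g dvd x - y * z})"
    unfolding poly_quotient_def quotient_module_def FactRing_def rcoset_mult_def cgenideal_coset
    by simp
  also have "\<dots> = (\<Union>y\<in>{x. g dvd x - r}. \<Union>z\<in>{x. g dvd x - a}. {x. g dvd x - r * a})"
    by (intro SUP_cong refl) (simp only: residue_class_eq_iff mem_Collect_eq cong)
  also have "\<dots> = {x. g dvd x - r * a}"
  proof -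
    have "r \<in> {x. g dvd x - r}" "a \<in> {x. g dvd x - a}" by simp_all
    thus ?thesis by blast
  qed
  finally show ?thesis .
qed

end

text \<open>\<open>V\<close> is the \<open>K[x]\<close>-module with generators indexed by \<open>I\<close> and relations \<open>d i\<close>;
  the coordinates outside \<open>I\<close> are ignored.\<close>

definition presents ::
    "nat \<Rightarrow> 'a :: field mat \<Rightarrow> 'a vec set \<Rightarrow> 'i set \<Rightarrow> ('i \<Rightarrow> 'a poly) \<Rightarrow> (('i \<Rightarrow> 'a poly) \<Rightarrow> 'a vec) \<Rightarrow> bool" where
  "presents n M V I d \<Phi> \<longleftrightarrow>
     range \<Phi> = V \<and>
     (\<forall>p q. \<Phi> (\<lambda>i. p i + q i) = \<Phi> p + \<Phi> q) \<and>
     (\<forall>r p. \<Phi> (\<lambda>i. r * p i) = poly_act M r (\<Phi> p)) \<and>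
     (\<forall>p. \<Phi> p = 0\<^sub>v n \<longleftrightarrow> (\<forall>i\<in>I. d i dvd p i))"

lemma
  assumes "presents n M V I d \<Phi>"
  shows presents_range: "range \<Phi> = V"
    and presents_add: "\<Phi> (\<lambda>i. p i + q i) = \<Phi> p + \<Phi> q"
    and presents_mult: "\<Phi> (\<lambda>i. r * p i) = poly_act M r (\<Phi> p)"
    and presents_zero_iff: "\<Phi> p = 0\<^sub>v n \<longleftrightarrow> (\<forall>i\<in>I. d i dvd p i)"
  using assms unfolding presents_def by simp_all

text \<open>\<open>\<Phi>\<close> is reduction to residue classes followed by the inverse of the
  given isomorphism. Once quotients and isomorphism are hidden in it, the two matrices can be
  compared through divisibility of polynomials alone.\<close>

lemma primary_component_presentation:
  fixes M :: "'a :: field mat"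
  assumes M: "M \<in> carrier_mat n n" and "is_primary_partition M f lam"
  shows "\<exists>\<Phi>. presents n M (primary_vecs n M f) {..<length lam} (\<lambda>j. f ^ (lam ! j)) \<Phi>"
proof -
  let ?V = "primary_component (matrix_module M) class_ring f"
  let ?N = "module_sum {..<length lam} (\<lambda>j. poly_quotient (f ^ (lam ! j)))"
  have dim: "dim_row M = n" using M by auto
  have carV: "carrier ?V = primary_vecs n M f"
    unfolding primary_component_def matrix_module_def primary_vecs_def dim
    by (simp add: class_ring_simps)
  have opsV: "u \<oplus>\<^bsub>?V\<^esub> v = u + v" "r \<odot>\<^bsub>?V\<^esub> v = poly_act M r v" for u v r
    unfolding primary_component_def matrix_module_def by simp_all
  obtain h where hom: "h \<in> LinearCombinations.module_hom class_ring ?V ?N"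
    and bij: "bij_betw h (carrier ?V) (carrier ?N)"
    using assms(2) unfolding is_primary_partition_def module_isomorphic_def by blast
  define \<kappa> where "\<kappa> p = (\<lambda>j\<in>{..<length lam}. {x. f ^ (lam ! j) dvd x - p j})" for p
  have \<kappa>_range: "range \<kappa> = carrier ?N"
  proof (intro equalityI subsetI)
    fix y assume "y \<in> range \<kappa>"
    thus "y \<in> carrier ?N" unfolding module_sum_def \<kappa>_def by (auto simp: poly_quotient_carrier)
  next
    fix y assume "y \<in> carrier ?N"
    hence y: "y \<in> (\<Pi>\<^sub>E j\<in>{..<length lam}. range (\<lambda>a. {x. f ^ (lam ! j) dvd x - a}))"
      unfolding module_sum_def by (simp add: poly_quotient_carrier)
    hence "\<forall>j\<in>{..<length lam}. \<exists>a. y j = {x. f ^ (lam ! j) dvd x - a}" by (auto simp: PiE_iff)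
    then obtain p where p: "\<And>j. j < length lam \<Longrightarrow> y j = {x. f ^ (lam ! j) dvd x - p j}" by (metis lessThan_iff)
    have "y = \<kappa> p"
    proof
      fix j show "y j = \<kappa> p j"
        using p y by (cases "j < length lam") (auto simp: \<kappa>_def PiE_iff extensional_def)
    qed
    thus "y \<in> range \<kappa>" by simp
  qed
  have \<kappa>_add: "\<kappa> p \<oplus>\<^bsub>?N\<^esub> \<kappa> q = \<kappa> (\<lambda>j. p j + q j)" for p q
    unfolding module_sum_def \<kappa>_def by (simp add: poly_quotient_add cong: restrict_cong)
  have \<kappa>_smult: "r \<odot>\<^bsub>?N\<^esub> \<kappa> p = \<kappa> (\<lambda>j. r * p j)" for p r
    unfolding module_sum_def \<kappa>_def by (simp add: poly_quotient_smult cong: restrict_cong)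
  have \<kappa>_eq: "\<kappa> p = \<kappa> q \<longleftrightarrow> (\<forall>j\<in>{..<length lam}. f ^ (lam ! j) dvd p j - q j)" for p q
  proof
    assume eq: "\<kappa> p = \<kappa> q"
    show "\<forall>j\<in>{..<length lam}. f ^ (lam ! j) dvd p j - q j"
    proof
      fix j assume "j \<in> {..<length lam}"
      hence "{x. f ^ (lam ! j) dvd x - p j} = {x. f ^ (lam ! j) dvd x - q j}"
        using fun_cong[OF eq, of j] by (simp add: \<kappa>_def)
      thus "f ^ (lam ! j) dvd p j - q j" by (simp only: residue_class_eq_iff)
    qed
  next
    assume "\<forall>j\<in>{..<length lam}. f ^ (lam ! j) dvd p j - q j"
    thus "\<kappa> p = \<kappa> q" unfolding \<kappa>_def by (intro restrict_ext) (simp only: residue_class_eq_iff)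
  qed
  define G where "G = inv_into (carrier ?V) h"
  have \<kappa>_im: "\<kappa> p \<in> h ` carrier ?V" for p using bij \<kappa>_range unfolding bij_betw_def by blast
  have inj: "inj_on h (carrier ?V)" using bij unfolding bij_betw_def by blast
  have G_in: "G (\<kappa> p) \<in> carrier ?V" for p
    unfolding G_def by (rule inv_into_into[OF \<kappa>_im])
  have hG: "h (G (\<kappa> p)) = \<kappa> p" for p
    unfolding G_def by (rule f_inv_into_f[OF \<kappa>_im])
  \<comment> \<open>Additivity, compatibility with the action and surjectivity of
    \<open>\<Phi>\<close> are each obtained by exhibiting a vector of the component with the right
    image under \<open>h\<close>.\<close>
  have G_eq: "G (\<kappa> p) = v" if "v \<in> carrier ?V" "h v = \<kappa> p" for p v
    unfolding G_def that(2)[symmetric] by (rule inv_into_f_f[OF inj that(1)])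
  have h_add: "h (u + v) = h u \<oplus>\<^bsub>?N\<^esub> h v" if "u \<in> carrier ?V" "v \<in> carrier ?V" for u v
    using hom that unfolding LinearCombinations.module_hom_def opsV by blast
  have h_smult: "h (poly_act M r v) = r \<odot>\<^bsub>?N\<^esub> h v" if "v \<in> carrier ?V" for r v
    using hom that unfolding LinearCombinations.module_hom_def opsV by simp
  define \<Phi> where "\<Phi> p = G (\<kappa> p)" for p
  have \<Phi>_in: "\<Phi> p \<in> carrier ?V" and h\<Phi>: "h (\<Phi> p) = \<kappa> p" for p
    unfolding \<Phi>_def using G_in hG by auto
  have \<Phi>_c: "\<Phi> p \<in> carrier_vec n" for p using \<Phi>_in[of p] unfolding carV primary_vecs_def by simp
  have V_smult: "poly_act M r v \<in> carrier ?V" if v: "v \<in> carrier ?V" for r v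
  proof -
    obtain k where k: "v \<in> carrier_vec n" "poly_act M (f ^ k) v = 0\<^sub>v n"
      using v unfolding carV primary_vecs_def by auto
    have "poly_act M (f ^ k) (poly_act M r v) = poly_act M r (poly_act M (f ^ k) v)"
      by (simp only: poly_act_mult[OF M k(1), symmetric] mult.commute)
    thus ?thesis using k M unfolding carV primary_vecs_def by auto
  qed
  have add: "\<Phi> (\<lambda>i. p i + q i) = \<Phi> p + \<Phi> q" for p q
    unfolding \<Phi>_def[of "\<lambda>i. p i + q i"]
    using \<Phi>_in[of p] \<Phi>_in[of q] primary_vecs_add[OF M, of "\<Phi> p" f "\<Phi> q"]
    by (intro G_eq) (simp_all add: carV h_add h\<Phi> \<kappa>_add)
  have smult: "\<Phi> (\<lambda>i. r * p i) = poly_act M r (\<Phi> p)" for r p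
    unfolding \<Phi>_def[of "\<lambda>i. r * p i"]
    using \<Phi>_in[of p] V_smult by (intro G_eq) (simp_all add: h_smult h\<Phi> \<kappa>_smult)
  have zero: "\<Phi> (\<lambda>i. 0) = 0\<^sub>v n"
    using smult[of 0] \<Phi>_c M by simp
  have "\<Phi> p = 0\<^sub>v n \<longleftrightarrow> \<kappa> p = \<kappa> (\<lambda>i. 0)" for p
  proof
    assume "\<Phi> p = 0\<^sub>v n"
    hence "h (\<Phi> p) = h (\<Phi> (\<lambda>i. 0))" by (simp only: zero)
    thus "\<kappa> p = \<kappa> (\<lambda>i. 0)" by (simp only: h\<Phi>)
  next
    assume "\<kappa> p = \<kappa> (\<lambda>i. 0)"
    hence "\<Phi> p = \<Phi> (\<lambda>i. 0)" by (simp only: \<Phi>_def)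
    thus "\<Phi> p = 0\<^sub>v n" by (simp only: zero)
  qed
  hence "\<Phi> p = 0\<^sub>v n \<longleftrightarrow> (\<forall>j\<in>{..<length lam}. f ^ (lam ! j) dvd p j)" for p
    by (simp add: \<kappa>_eq)
  moreover have "range \<Phi> = primary_vecs n M f"
  proof (intro equalityI subsetI)
    fix v assume "v \<in> range \<Phi>"
    thus "v \<in> primary_vecs n M f" using \<Phi>_in carV by auto
  next
    fix v assume v: "v \<in> primary_vecs n M f"
    hence "h v \<in> carrier ?N" using bij carV unfolding bij_betw_def by auto
    then obtain p where "h v = \<kappa> p" using \<kappa>_range by auto
    hence "\<Phi> p = v" unfolding \<Phi>_def using v carV by (intro G_eq) auto
    thus "v \<in> range \<Phi>" by auto
  qed
  ultimately show ?thesis unfolding presents_def using add smult by blast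
qed

lemma char_poly_neq_0:
  fixes M :: "'a :: field mat"
  assumes "M \<in> carrier_mat n n"
  shows "char_poly M \<noteq> 0"
  using degree_monic_char_poly[OF assms] by auto

lemma finite_char_factors:
  fixes M :: "'a :: {field, finite} mat"
  assumes "M \<in> carrier_mat n n"
  shows "finite (char_factors M)"
proof (rule finite_subset[OF _ finite_degree_less])
  show "char_factors M \<subseteq> {f. degree f < Suc (degree (char_poly M))}"
    using char_poly_neq_0[OF assms] by (auto simp: char_factors_def less_Suc_eq_le intro: dvd_imp_degree_le)
qed

text \<open>The presentations of the primary components are added up: the decomposition makes the
  sum surjective, and independence of the components makes its relations the union of
  theirs.\<close>

lemma matrix_module_presentation:
  fixes M :: "'a :: field mat"
  assumes M: "M \<in> carrier_mat n n" and fin: "finite (char_factors M)"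
    and lam: "\<And>f. f \<in> char_factors M \<Longrightarrow> is_primary_partition M f (lam f)"
  shows "\<exists>\<Psi>. presents n M (carrier_vec n) (Sigma (char_factors M) (\<lambda>f. {..<length (lam f)}))
           (\<lambda>(f, j). f ^ (lam f ! j)) \<Psi>"
proof -
  let ?S = "char_factors M"
  have S: "irreducible f \<and> lead_coeff f = 1" if "f \<in> ?S" for f using that by (simp add: char_factors_def)
  have "\<forall>f\<in>?S. \<exists>\<Phi>. presents n M (primary_vecs n M f) {..<length (lam f)} (\<lambda>j. f ^ (lam f ! j)) \<Phi>"
    using primary_component_presentation[OF M] lam by blast
  then obtain \<Phi> where
    \<Phi>: "\<And>f. f \<in> ?S \<Longrightarrow> presents n M (primary_vecs n M f) {..<length (lam f)} (\<lambda>j. f ^ (lam f ! j)) (\<Phi> f)"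
    by metis
  define w where "w p f = \<Phi> f (\<lambda>j. p (f, j))" for p f
  have w: "w p f \<in> primary_vecs n M f" if "f \<in> ?S" for p f
    using presents_range[OF \<Phi>[OF that]] unfolding w_def by blast
  have wc: "w p f \<in> carrier_vec n" if "f \<in> ?S" for p f
    using w[OF that] by (simp add: primary_vecs_def)
  define \<Psi> where "\<Psi> p = finsum_vec TYPE('a) n (w p) ?S" for p
  have \<Psi>c: "\<Psi> p \<in> carrier_vec n" for p unfolding \<Psi>_def using wc by simp
  have "\<Psi> (\<lambda>i. p i + q i) = \<Psi> p + \<Psi> q" for p q
  proof (rule eq_vecI)
    show "dim_vec (\<Psi> (\<lambda>i. p i + q i)) = dim_vec (\<Psi> p + \<Psi> q)" by (simp add: carrier_vecD[OF \<Psi>c])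
    fix k assume "k < dim_vec (\<Psi> p + \<Psi> q)"
    hence k: "k < n" by (simp add: carrier_vecD[OF \<Psi>c])
    have "\<Psi> (\<lambda>i. p i + q i) $ k = (\<Sum>f\<in>?S. w (\<lambda>i. p i + q i) f $ k)"
      unfolding \<Psi>_def using fin k wc by (rule finsum_vec_index)
    also have "\<dots> = (\<Sum>f\<in>?S. w p f $ k + w q f $ k)"
    proof (rule sum.cong[OF refl])
      fix f assume f: "f \<in> ?S"
      hence "w (\<lambda>i. p i + q i) f = w p f + w q f" by (simp only: w_def presents_add[OF \<Phi>[OF f]])
      thus "w (\<lambda>i. p i + q i) f $ k = w p f $ k + w q f $ k" using k carrier_vecD[OF wc[OF f]] by simp
    qed
    also have "\<dots> = \<Psi> p $ k + \<Psi> q $ k"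
      using k fin wc by (simp add: \<Psi>_def sum.distrib finsum_vec_index)
    also have "\<dots> = (\<Psi> p + \<Psi> q) $ k" using k carrier_vecD[OF \<Psi>c, of q] by simp
    finally show "\<Psi> (\<lambda>i. p i + q i) $ k = (\<Psi> p + \<Psi> q) $ k" .
  qed
  moreover have "\<Psi> (\<lambda>i. r * p i) = poly_act M r (\<Psi> p)" for r p
  proof -
    have weq: "w (\<lambda>i. r * p i) f = poly_act M r (w p f)" if "f \<in> ?S" for f
      by (simp only: w_def presents_mult[OF \<Phi>[OF that]])
    have "poly_act M r (\<Psi> p) = finsum_vec TYPE('a) n (\<lambda>f. poly_act M r (w p f)) ?S"
      unfolding \<Psi>_def using fin wc by (simp add: poly_act_finsum_right[OF M])
    also have "\<dots> = \<Psi> (\<lambda>i. r * p i)"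
    proof (rule eq_vecI)
      have s: "finsum_vec TYPE('a) n (\<lambda>f. poly_act M r (w p f)) ?S \<in> carrier_vec n" using wc M by simp
      show "dim_vec (finsum_vec TYPE('a) n (\<lambda>f. poly_act M r (w p f)) ?S) = dim_vec (\<Psi> (\<lambda>i. r * p i))"
        by (simp only: carrier_vecD[OF \<Psi>c] carrier_vecD[OF s])
      fix k assume "k < dim_vec (\<Psi> (\<lambda>i. r * p i))"
      hence k: "k < n" by (simp add: carrier_vecD[OF \<Psi>c])
      show "finsum_vec TYPE('a) n (\<lambda>f. poly_act M r (w p f)) ?S $ k = \<Psi> (\<lambda>i. r * p i) $ k"
        unfolding \<Psi>_def using fin k wc M by (simp add: finsum_vec_index weq)
    qed
    finally show ?thesis by simp
  qed
  moreover have "\<Psi> p = 0\<^sub>v n \<longleftrightarrow>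
      (\<forall>i\<in>Sigma ?S (\<lambda>f. {..<length (lam f)}). (case i of (f, j) \<Rightarrow> f ^ (lam f ! j)) dvd p i)" for p
  proof -
    have "\<Psi> p = 0\<^sub>v n \<longleftrightarrow> (\<forall>f\<in>?S. w p f = 0\<^sub>v n)"
    proof
      assume "\<Psi> p = 0\<^sub>v n"
      hence "finsum_vec TYPE('a) n (w p) ?S = 0\<^sub>v n" by (simp only: \<Psi>_def)
      from primary_independent[OF M fin S w this] show "\<forall>f\<in>?S. w p f = 0\<^sub>v n" by simp
    next
      assume "\<forall>f\<in>?S. w p f = 0\<^sub>v n"
      thus "\<Psi> p = 0\<^sub>v n" unfolding \<Psi>_def using fin by (intro finsum_vec_zero) auto
    qed
    moreover have "w p f = 0\<^sub>v n \<longleftrightarrow> (\<forall>j\<in>{..<length (lam f)}. f ^ (lam f ! j) dvd p (f, j))" if "f \<in> ?S" for f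
      by (simp only: w_def presents_zero_iff[OF \<Phi>[OF that]])
    ultimately show ?thesis by auto
  qed
  moreover have "range \<Psi> = carrier_vec n"
  proof (intro equalityI subsetI)
    fix v :: "'a vec" assume v: "v \<in> carrier_vec n"
    have "\<exists>u. (\<forall>f\<in>?S. u f \<in> primary_vecs n M f) \<and> v = finsum_vec TYPE('a) n u ?S"
      by (rule primary_decomposition[OF M fin char_poly_neq_0[OF M] v cayley_hamilton[OF M v]])
         (simp add: char_factors_def)
    then obtain u where u: "\<And>f. f \<in> ?S \<Longrightarrow> u f \<in> primary_vecs n M f"
      and vu: "v = finsum_vec TYPE('a) n u ?S" by blast
    have "\<forall>f\<in>?S. \<exists>p. u f = \<Phi> f p" using u presents_range[OF \<Phi>] by blast
    then obtain p where p: "\<And>f. f \<in> ?S \<Longrightarrow> u f = \<Phi> f (p f)" by metis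
    have "u f = w (\<lambda>(f, j). p f j) f" if "f \<in> ?S" for f using p[OF that] by (simp add: w_def)
    hence "v = \<Psi> (\<lambda>(f, j). p f j)"
      unfolding vu \<Psi>_def
    proof (intro eq_vecI, goal_cases)
      case (1 k)
      hence k: "k < n" using carrier_vecD[OF \<Psi>c] unfolding \<Psi>_def by simp
      have uc: "u f \<in> carrier_vec n" if "f \<in> ?S" for f using u[OF that] by (simp add: primary_vecs_def)
      show ?case using k fin wc uc 1 by (simp add: finsum_vec_index)
    next
      case 2
      show ?case using carrier_vecD[OF \<Psi>c] carrier_vecD[OF v] unfolding vu \<Psi>_def by simp
    qed
    thus "v \<in> range \<Psi>" by blast
  qed (use \<Psi>c in auto)
  ultimately show ?thesis unfolding presents_def by blast
qed

text \<open>Composition with \<open>a\<close> turns the relations of the first presentation exactly into those of the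
  second, so it induces an \<open>a\<close>-semilinear injection.\<close>

lemma presentation_transfer:
  fixes X Y :: "'a :: field mat" and \<tau> :: "'j \<Rightarrow> 'i"
  assumes X: "X \<in> carrier_mat n n" and Y: "Y \<in> carrier_mat n n"
    and \<Phi>: "presents n X (carrier_vec n) I d \<Phi>" and \<Psi>: "presents n Y (carrier_vec n) J e \<Psi>"
    and \<tau>: "\<tau> ` J = I" and de: "\<And>j p. j \<in> J \<Longrightarrow> e j dvd pcompose p a \<longleftrightarrow> d (\<tau> j) dvd p"
  shows "\<exists>T. (\<forall>v\<in>carrier_vec n. T v \<in> carrier_vec n) \<and>
     (\<forall>v\<in>carrier_vec n. \<forall>w\<in>carrier_vec n. T (v + w) = T v + T w) \<and>
     (\<forall>r. \<forall>v\<in>carrier_vec n. T (poly_act X r v) = poly_act Y (pcompose r a) (T v)) \<and>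
     (\<forall>v\<in>carrier_vec n. T v = 0\<^sub>v n \<longrightarrow> v = 0\<^sub>v n)"
proof -
  define E where "E p = (\<lambda>j. pcompose (p (\<tau> j)) a)" for p :: "'i \<Rightarrow> 'a poly"
  \<comment> \<open>\<open>s\<close> chooses arbitrary preimages under \<open>\<Phi>\<close>; that
    \<open>T\<close> does not depend on the choice is the content of \<open>T\<Phi>\<close>
    below.\<close>
  define s where "s v = (SOME p. \<Phi> p = v)" for v
  define T where "T v = \<Psi> (E (s v))" for v
  have \<Phi>c: "\<Phi> p \<in> carrier_vec n" for p using presents_range[OF \<Phi>] by blast
  have \<Psi>c: "\<Psi> p \<in> carrier_vec n" for p using presents_range[OF \<Psi>] by blast
  have s: "\<Phi> (s v) = v" if v: "v \<in> carrier_vec n" for v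
  proof -
    have "v \<in> range \<Phi>" using v presents_range[OF \<Phi>] by simp
    hence "\<exists>p. \<Phi> p = v" by auto
    thus ?thesis unfolding s_def by (rule someI_ex)
  qed
  \<comment> \<open>The right-to-left direction makes \<open>T\<close> well defined, the other one
    makes it injective. That \<tau> maps onto \<open>I\<close> ensures that every relation of the
    first presentation is tested.\<close>
  have E0: "\<Psi> (E p) = 0\<^sub>v n \<longleftrightarrow> \<Phi> p = 0\<^sub>v n" for p
  proof -
    have "\<Psi> (E p) = 0\<^sub>v n \<longleftrightarrow> (\<forall>j\<in>J. d (\<tau> j) dvd p (\<tau> j))"
      unfolding presents_zero_iff[OF \<Psi>] using de by (simp add: E_def)
    also have "\<dots> \<longleftrightarrow> (\<forall>i\<in>I. d i dvd p i)" unfolding \<tau>[symmetric] by simp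
    also have "\<dots> \<longleftrightarrow> \<Phi> p = 0\<^sub>v n" unfolding presents_zero_iff[OF \<Phi>] ..
    finally show ?thesis .
  qed
  have \<Phi>add: "\<Phi> (\<lambda>i. p i + q i) = \<Phi> p + \<Phi> q" and \<Phi>mult: "\<Phi> (\<lambda>i. r * p i) = poly_act X r (\<Phi> p)" for p q r
    by (rule presents_add[OF \<Phi>], rule presents_mult[OF \<Phi>])
  have \<Psi>add: "\<Psi> (\<lambda>i. p i + q i) = \<Psi> p + \<Psi> q" and \<Psi>mult: "\<Psi> (\<lambda>i. r * p i) = poly_act Y r (\<Psi> p)" for p q r
    by (rule presents_add[OF \<Psi>], rule presents_mult[OF \<Psi>])
  have Eadd: "\<Psi> (E (\<lambda>i. p i + q i)) = \<Psi> (E p) + \<Psi> (E q)" for p q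
    unfolding \<Psi>add[symmetric] by (simp add: E_def pcompose_add)
  have Emult: "\<Psi> (E (\<lambda>i. r * p i)) = poly_act Y (pcompose r a) (\<Psi> (E p))" for r p
    unfolding \<Psi>mult[symmetric] by (simp add: E_def pcompose_mult)
  have T\<Phi>: "T (\<Phi> p) = \<Psi> (E p)" for p
  proof -
    \<comment> \<open>The difference of two preimages of the same vector, hence a relation, which
      \<open>E\<close> carries to a relation.\<close>
    define m where "m = (\<lambda>i. s (\<Phi> p) i + (-1) * p i)"
    have neg: "poly_act A (-1) v = - v" if "A \<in> carrier_mat n n" "v \<in> carrier_vec n" for A v
      using poly_act_const[OF that, of "-1"] by (simp add: one_pCons uminus_vec_def smult_vec_def)
    have "\<Phi> m = \<Phi> p + - \<Phi> p"
      unfolding m_def \<Phi>add \<Phi>mult s[OF \<Phi>c] neg[OF X \<Phi>c] ..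
    hence "\<Phi> m = 0\<^sub>v n" using \<Phi>c[of p] by simp
    hence "\<Psi> (E m) = 0\<^sub>v n" by (simp add: E0)
    moreover have "\<Psi> (E m) = T (\<Phi> p) + - \<Psi> (E p)"
      unfolding m_def Eadd Emult T_def by (simp add: neg[OF Y \<Psi>c] pcompose_uminus pcompose_1)
    ultimately have *: "T (\<Phi> p) + - \<Psi> (E p) = 0\<^sub>v n" by simp
    show ?thesis
    proof (rule eq_vecI)
      have Tc: "T (\<Phi> p) \<in> carrier_vec n" unfolding T_def by (rule \<Psi>c)
      show "dim_vec (T (\<Phi> p)) = dim_vec (\<Psi> (E p))"
        by (simp only: carrier_vecD[OF Tc] carrier_vecD[OF \<Psi>c])
      fix k assume "k < dim_vec (\<Psi> (E p))"
      hence k: "k < n" by (simp only: carrier_vecD[OF \<Psi>c])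
      have "(T (\<Phi> p) + - \<Psi> (E p)) $ k = 0" unfolding * using k by simp
      thus "T (\<Phi> p) $ k = \<Psi> (E p) $ k" using k carrier_vecD[OF \<Psi>c] by simp
    qed
  qed
  show ?thesis
  proof (intro exI[of _ T] conjI ballI allI impI)
    fix v :: "'a vec" assume v: "v \<in> carrier_vec n"
    show "T v \<in> carrier_vec n" unfolding T_def by (rule \<Psi>c)
    show "T (v + w) = T v + T w" if w: "w \<in> carrier_vec n" for w
      using T\<Phi>[of "\<lambda>i. s v i + s w i"] unfolding Eadd \<Phi>add s[OF v] s[OF w] T_def .
    show "T (poly_act X r v) = poly_act Y (pcompose r a) (T v)" for r
      using T\<Phi>[of "\<lambda>i. r * s v i"] unfolding Emult \<Phi>mult s[OF v] T_def .
    show "v = 0\<^sub>v n" if "T v = 0\<^sub>v n"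
      using that unfolding T_def E0 s[OF v] .
  qed
qed

subsection \<open>Centralizers\<close>

text \<open>Elements with equal labels are paired off one at a time. With class type terms as
  labels, this matches the irreducible factors of \<open>Y\<close> with those of
  \<open>X\<close>.\<close>

lemma image_mset_eq_obtain_map:
  assumes "finite A" "finite B"
    and "image_mset F (mset_set A) = image_mset G (mset_set B)"
  shows "\<exists>\<sigma>. \<sigma> ` B = A \<and> (\<forall>b\<in>B. F (\<sigma> b) = G b)"
  using assms(2,1,3)
proof (induction B arbitrary: A)
  case empty
  thus ?case by (auto simp: mset_set_empty_iff)
next
  case (insert b B)
  have "G b \<in># image_mset F (mset_set A)" unfolding insert.prems(2) using insert.hyps by simp
  hence "G b \<in> F ` A" using insert.prems(1) by simp
  then obtain a where a: "a \<in> A" "F a = G b" by (metis imageE)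
  have "mset_set A = add_mset a (mset_set (A - {a}))"
    using a insert.prems(1) by (simp add: mset_set.remove)
  hence "image_mset F (mset_set (A - {a})) = image_mset G (mset_set B)"
    using insert a by simp
  then obtain \<sigma> where \<sigma>: "\<sigma> ` B = A - {a}" "\<forall>b\<in>B. F (\<sigma> b) = G b"
    using insert.IH[of "A - {a}"] insert.prems(1) by auto
  have "(\<sigma>(b := a)) ` insert b B = insert a (\<sigma> ` B)" using insert.hyps by (auto simp: image_iff)
  moreover have "insert a (\<sigma> ` B) = A" using \<sigma> a by auto
  moreover have "\<forall>c\<in>insert b B. F ((\<sigma>(b := a)) c) = G c" using \<sigma> a by auto
  ultimately show ?case by (intro exI[of _ "\<sigma>(b := a)"]) simp
qed

lemma linear_map_matrix:
  fixes T :: "'a :: comm_ring_1 vec \<Rightarrow> 'a vec"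
  assumes Tc: "\<And>v. v \<in> carrier_vec n \<Longrightarrow> T v \<in> carrier_vec n"
    and add: "\<And>v w. v \<in> carrier_vec n \<Longrightarrow> w \<in> carrier_vec n \<Longrightarrow> T (v + w) = T v + T w"
    and smult: "\<And>c v. v \<in> carrier_vec n \<Longrightarrow> T (c \<cdot>\<^sub>v v) = c \<cdot>\<^sub>v T v"
  shows "\<exists>P\<in>carrier_mat n n. \<forall>v\<in>carrier_vec n. P *\<^sub>v v = T v"
proof -
  define P where "P = mat n n (\<lambda>(i, j). T (unit_vec n j) $ i)"
  have zero: "T (0\<^sub>v n) = 0\<^sub>v n"
    using smult[of "0\<^sub>v n" 0] Tc[of "0\<^sub>v n"] by simp
  have fin: "T (finsum_vec TYPE('a) n w S) = finsum_vec TYPE('a) n (\<lambda>s. T (w s)) S"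
    if "finite S" "\<And>s. s \<in> S \<Longrightarrow> w s \<in> carrier_vec n" for w and S :: "nat set"
    using that
  proof (induction S)
    case empty
    show ?case by (simp add: finsum_vec_empty zero)
  next
    case (insert s S)
    have "w \<in> S \<rightarrow> carrier_vec n" "(\<lambda>s. T (w s)) \<in> S \<rightarrow> carrier_vec n"
      "w s \<in> carrier_vec n" "T (w s) \<in> carrier_vec n"
      using insert.prems Tc by auto
    thus ?case using insert by (simp add: finsum_vec_insert finsum_vec_closed add)
  qed
  have "P *\<^sub>v v = T v" if v: "v \<in> carrier_vec n" for v
  proof (rule eq_vecI)
    show "dim_vec (P *\<^sub>v v) = dim_vec (T v)" using carrier_vecD[OF Tc[OF v]] by (simp add: P_def)
    fix i assume "i < dim_vec (T v)"
    hence i: "i < n" using carrier_vecD[OF Tc[OF v]] by simp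
    have "T v = T (finsum_vec TYPE('a) n (\<lambda>j. v $ j \<cdot>\<^sub>v unit_vec n j) {..<n})"
      by (simp only: finsum_vec_unit_expansion[OF v, symmetric])
    also have "\<dots> = finsum_vec TYPE('a) n (\<lambda>j. T (v $ j \<cdot>\<^sub>v unit_vec n j)) {..<n}"
      by (rule fin) auto
    also have "\<dots> $ i = (\<Sum>j<n. T (v $ j \<cdot>\<^sub>v unit_vec n j) $ i)"
      by (rule finsum_vec_index) (use i Tc in auto)
    also have "\<dots> = (\<Sum>j<n. T (unit_vec n j) $ i * v $ j)"
      using i carrier_vecD[OF Tc[OF unit_vec_carrier]] by (intro sum.cong) (auto simp: smult mult.commute)
    also have "\<dots> = (P *\<^sub>v v) $ i"
      using i carrier_vecD[OF v] by (simp add: P_def scalar_prod_def lessThan_atLeast0)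
    finally show "(P *\<^sub>v v) $ i = T v $ i" by simp
  qed
  moreover have "P \<in> carrier_mat n n" by (simp add: P_def)
  ultimately show ?thesis by blast
qed

lemma eq_mat_if_eq_on_vecs:
  fixes A B :: "'a :: comm_ring_1 mat"
  assumes A: "A \<in> carrier_mat n n" and B: "B \<in> carrier_mat n n"
    and eq: "\<And>v. v \<in> carrier_vec n \<Longrightarrow> A *\<^sub>v v = B *\<^sub>v v"
  shows "A = B"
proof (rule eq_matI)
  fix i j assume "i < dim_row B" "j < dim_col B"
  hence ij: "i < n" "j < n" using B by auto
  have "(A *\<^sub>v unit_vec n j) $ i = (B *\<^sub>v unit_vec n j) $ i" using eq by simp
  thus "A $$ (i, j) = B $$ (i, j)" using ij A B by auto
qed (use A B in auto)

lemma invertible_if_inj: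
  fixes P :: "'a :: field mat"
  assumes P: "P \<in> carrier_mat n n"
    and inj: "\<And>v. v \<in> carrier_vec n \<Longrightarrow> P *\<^sub>v v = 0\<^sub>v n \<Longrightarrow> v = 0\<^sub>v n"
  shows "\<exists>Q\<in>carrier_mat n n. P * Q = 1\<^sub>m n \<and> Q * P = 1\<^sub>m n"
proof -
  have "det P \<noteq> 0" using det_0_iff_vec_prod_zero_field[OF P] inj by blast
  from det_non_zero_imp_unit[OF P this, of "()"] show ?thesis
    unfolding Units_def by (auto simp: ring_mat_simps)
qed

text \<open>The similarity of \<open>X\<close> and a(Y), stated on vectors because a(Y) is available
  only through its action.\<close>

lemma same_class_type_intertwiner:
  fixes X Y :: "'a :: {field, finite} mat"
  assumes X: "X \<in> carrier_mat n n" and Y: "Y \<in> carrier_mat n n" and same: "same_class_type X Y"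
  shows "\<exists>a. \<exists>P\<in>carrier_mat n n. \<exists>Q\<in>carrier_mat n n. P * Q = 1\<^sub>m n \<and> Q * P = 1\<^sub>m n \<and>
    (\<forall>v\<in>carrier_vec n. P *\<^sub>v (X *\<^sub>v v) = poly_act Y a (P *\<^sub>v v))"
proof -
  let ?A = "char_factors X" and ?B = "char_factors Y"
  obtain lam mu where lam: "\<And>f. f \<in> ?A \<Longrightarrow> is_primary_partition X f (lam f)"
    and mu: "\<And>g. g \<in> ?B \<Longrightarrow> is_primary_partition Y g (mu g)"
    and eq: "image_mset (\<lambda>f. (degree f, lam f)) (mset_set ?A) = image_mset (\<lambda>g. (degree g, mu g)) (mset_set ?B)"
    using same unfolding same_class_type_def has_class_type_def by auto
  have finA: "finite ?A" and finB: "finite ?B" using finite_char_factors X Y by auto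
  obtain \<sigma> where \<sigma>: "\<sigma> ` ?B = ?A"
    and \<sigma>eq: "\<And>g. g \<in> ?B \<Longrightarrow> degree (\<sigma> g) = degree g \<and> lam (\<sigma> g) = mu g"
    using image_mset_eq_obtain_map[OF finA finB eq] by auto
  have irrA: "irreducible f" if "f \<in> ?A" for f using that by (simp add: char_factors_def)
  have irrB: "irreducible g \<and> lead_coeff g = 1" if "g \<in> ?B" for g using that by (simp add: char_factors_def)
  have \<sigma>irr: "irreducible (\<sigma> g)" if "g \<in> ?B" for g using irrA \<sigma> that by blast
  obtain a where a: "\<And>g. g \<in> ?B \<Longrightarrow> g dvd pcompose (\<sigma> g) a \<and> \<not> g\<^sup>2 dvd pcompose (\<sigma> g) a"
    using exists_simultaneous_simple_root[OF finB irrB, of \<sigma>] \<sigma>irr \<sigma>eq by blast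
  define I where "I = Sigma ?A (\<lambda>f. {..<length (lam f)})"
  define J where "J = Sigma ?B (\<lambda>g. {..<length (mu g)})"
  define d where "d = (\<lambda>(f, j). f ^ (lam f ! j))"
  define e where "e = (\<lambda>(g, j). g ^ (mu g ! j))"
  define \<tau> where "\<tau> = map_prod \<sigma> (id :: nat \<Rightarrow> nat)"
  obtain \<Phi> where \<Phi>: "presents n X (carrier_vec n) I d \<Phi>"
    using matrix_module_presentation[OF X finA lam] unfolding I_def d_def by blast
  obtain \<Psi> where \<Psi>: "presents n Y (carrier_vec n) J e \<Psi>"
    using matrix_module_presentation[OF Y finB mu] unfolding J_def e_def by blast
  have \<tau>: "\<tau> ` J = I"
  proof (intro equalityI subsetI)
    fix i assume "i \<in> \<tau> ` J"
    thus "i \<in> I" using \<sigma> \<sigma>eq unfolding \<tau>_def I_def J_def by auto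
  next
    fix i assume "i \<in> I"
    then obtain f j where i: "i = (f, j)" "f \<in> ?A" "j < length (lam f)" unfolding I_def by auto
    then obtain g where "g \<in> ?B" "f = \<sigma> g" using \<sigma> by blast
    thus "i \<in> \<tau> ` J" using i \<sigma>eq unfolding \<tau>_def J_def by (intro image_eqI[of _ _ "(g, j)"]) auto
  qed
  have de: "e x dvd pcompose p a \<longleftrightarrow> d (\<tau> x) dvd p" if xJ: "x \<in> J" for x p
  proof -
    obtain g j where x: "x = (g, j)" "g \<in> ?B" using xJ unfolding J_def by auto
    have "g ^ (mu g ! j) dvd pcompose p a \<longleftrightarrow> \<sigma> g ^ (mu g ! j) dvd p"
      using power_dvd_pcompose_iff[of "\<sigma> g" g a "mu g ! j" p] \<sigma>irr irrB a x(2) by blast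
    thus ?thesis using \<sigma>eq[OF x(2)] unfolding x(1) e_def d_def \<tau>_def by simp
  qed
  obtain T where Tc: "\<And>v. v \<in> carrier_vec n \<Longrightarrow> T v \<in> carrier_vec n"
    and Tadd: "\<And>v w. v \<in> carrier_vec n \<Longrightarrow> w \<in> carrier_vec n \<Longrightarrow> T (v + w) = T v + T w"
    and Tact: "\<And>r v. v \<in> carrier_vec n \<Longrightarrow> T (poly_act X r v) = poly_act Y (pcompose r a) (T v)"
    and Tinj: "\<And>v. v \<in> carrier_vec n \<Longrightarrow> T v = 0\<^sub>v n \<Longrightarrow> v = 0\<^sub>v n"
    using presentation_transfer[OF X Y \<Phi> \<Psi> \<tau> de] by blast
  \<comment> \<open>Composition with \<open>a\<close> fixes constant polynomials, so the semilinear
    map is linear over K.\<close>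
  have "T (c \<cdot>\<^sub>v v) = c \<cdot>\<^sub>v T v" if v: "v \<in> carrier_vec n" for c v
    using Tact[OF v, of "[:c:]"] by (simp add: poly_act_const[OF X v] poly_act_const[OF Y Tc[OF v]])
  then obtain P where P: "P \<in> carrier_mat n n" and PT: "\<And>v. v \<in> carrier_vec n \<Longrightarrow> P *\<^sub>v v = T v"
    using linear_map_matrix[of n T] Tc Tadd by blast
  obtain Q where Q: "Q \<in> carrier_mat n n" "P * Q = 1\<^sub>m n" "Q * P = 1\<^sub>m n"
    using invertible_if_inj[OF P] PT Tinj by metis
  \<comment> \<open>The polynomial x acts as \<open>X\<close> on one side, and its composition with
    \<open>a\<close> is \<open>a\<close> itself on the other.\<close>
  have "P *\<^sub>v (X *\<^sub>v v) = poly_act Y a (P *\<^sub>v v)" if v: "v \<in> carrier_vec n" for v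
    using Tact[OF v, of "[:0, 1:]"] PT[OF v] PT[of "X *\<^sub>v v"] X v
    by (simp add: poly_act_X[OF X v] pcompose_pCons)
  thus ?thesis using P Q by blast
qed

section \<open>Conjugating and counting finite centralizers\<close>

lemma finite_carrier_mat: "finite (carrier_mat n m :: 'a :: finite mat set)"
proof (rule finite_subset)
  show "carrier_mat n m \<subseteq> mat n m ` (({..<n} \<times> {..<m}) \<rightarrow>\<^sub>E (UNIV :: 'a set))"
  proof
    fix A :: "'a mat" assume A: "A \<in> carrier_mat n m"
    have "A = mat n m (\<lambda>ij\<in>{..<n} \<times> {..<m}. A $$ ij)" using A by (intro eq_matI) auto
    thus "A \<in> mat n m ` (({..<n} \<times> {..<m}) \<rightarrow>\<^sub>E UNIV)"
      by (intro image_eqI[where x = "\<lambda>ij\<in>{..<n} \<times> {..<m}. A $$ ij"]) auto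
  qed
  show "finite (mat n m ` (({..<n} \<times> {..<m}) \<rightarrow>\<^sub>E (UNIV :: 'a set)))"
    by (intro finite_imageI finite_PiE) auto
qed

lemma cancel_conjugation:
  fixes P Q A :: "'a :: comm_ring_1 mat"
  assumes "P \<in> carrier_mat n n" "Q \<in> carrier_mat n n" "A \<in> carrier_mat n n" "P * Q = 1\<^sub>m n"
  shows "P * (Q * A * P) * Q = A"
proof -
  have "P * (Q * A * P) * Q = (P * Q) * A * (P * Q)"
    using assms(1-3) by (simp add: assoc_mult_mat[of _ n n _ n _ n])
  thus ?thesis using assms by simp
qed

lemma same_class_type_centralizer_embedding:
  fixes X Y :: "'a :: {field, finite} mat"
  assumes X: "X \<in> carrier_mat n n" and Y: "Y \<in> carrier_mat n n" and same: "same_class_type X Y"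
  shows "\<exists>P\<in>carrier_mat n n. \<exists>Q\<in>carrier_mat n n. P * Q = 1\<^sub>m n \<and> Q * P = 1\<^sub>m n \<and>
    (\<lambda>B. Q * B * P) ` mat_centralizer n Y \<subseteq> mat_centralizer n X"
proof -
  obtain a P Q where P: "P \<in> carrier_mat n n" and Q: "Q \<in> carrier_mat n n"
    and inv: "P * Q = 1\<^sub>m n" "Q * P = 1\<^sub>m n"
    and PX: "\<And>v. v \<in> carrier_vec n \<Longrightarrow> P *\<^sub>v (X *\<^sub>v v) = poly_act Y a (P *\<^sub>v v)"
    using same_class_type_intertwiner[OF assms] by blast
  note assoc = assoc_mult_mat[of _ n n _ n _ n]
  \<comment> \<open>\<open>Z\<close> is the matrix a(Y), obtained as the conjugate of
    \<open>X\<close>; commuting with \<open>Z\<close> is carried to commuting with \<open>X\<close>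
    through \<open>Z * P = P * X\<close> and \<open>Q * Z = X * Q\<close>.\<close>
  define Z where "Z = P * X * Q"
  have Z: "Z \<in> carrier_mat n n" unfolding Z_def using P X Q by simp
  have Zact: "Z *\<^sub>v v = poly_act Y a v" if v: "v \<in> carrier_vec n" for v
  proof -
    have Qv: "Q *\<^sub>v v \<in> carrier_vec n" using Q v by simp
    have "Z *\<^sub>v v = P *\<^sub>v (X *\<^sub>v (Q *\<^sub>v v))"
      unfolding Z_def using P X Q v by (simp add: assoc_mult_mat_vec[of _ n n _ n])
    also have "\<dots> = poly_act Y a ((P * Q) *\<^sub>v v)"
      using PX[OF Qv] P Q v by (simp add: assoc_mult_mat_vec[of _ n n _ n])
    finally show ?thesis using inv v by simp
  qed
  have "Q * B * P \<in> mat_centralizer n X" if "B \<in> mat_centralizer n Y" for B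
  proof -
    have B: "B \<in> carrier_mat n n" "B * Y = Y * B" using that unfolding mat_centralizer_def by auto
    have BZ: "B * Z = Z * B"
    proof (rule eq_mat_if_eq_on_vecs)
      fix v :: "'a vec" assume v: "v \<in> carrier_vec n"
      have "(B * Z) *\<^sub>v v = B *\<^sub>v poly_act Y a v"
        using B Z v Zact by (simp add: assoc_mult_mat_vec[of _ n n _ n])
      also have "\<dots> = poly_act Y a (B *\<^sub>v v)" using poly_act_commute[OF Y v B] by simp
      also have "\<dots> = (Z * B) *\<^sub>v v" using B Z v Zact by (simp add: assoc_mult_mat_vec[of _ n n _ n])
      finally show "(B * Z) *\<^sub>v v = (Z * B) *\<^sub>v v" .
    qed (use B Z in auto)
    have "Z * P = P * X * (Q * P)" unfolding Z_def using P X Q by (simp add: assoc)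
    hence ZP: "Z * P = P * X" using inv P X by simp
    have "Q * Z = (Q * P) * X * Q" unfolding Z_def using P X Q by (simp add: assoc)
    hence QZ: "Q * Z = X * Q" using inv Q X by simp
    have "(Q * B * P) * X = Q * B * (Z * P)" unfolding ZP using P X Q B by (simp add: assoc)
    also have "\<dots> = Q * (B * Z) * P" using P Z Q B by (simp add: assoc)
    also have "\<dots> = (Q * Z) * B * P" unfolding BZ using P Z Q B by (simp add: assoc)
    also have "\<dots> = X * (Q * B * P)" unfolding QZ using P X Q B by (simp add: assoc)
    finally show ?thesis unfolding mat_centralizer_def using P Q B by simp
  qed
  thus ?thesis using P Q inv by blast
qed

lemma inj_on_conjugation:
  fixes P Q :: "'a :: field mat"
  assumes "P \<in> carrier_mat n n" "Q \<in> carrier_mat n n" "P * Q = 1\<^sub>m n"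
  shows "inj_on (\<lambda>B. Q * B * P) (mat_centralizer n Y)"
proof (rule inj_on_inverseI)
  fix B assume "B \<in> mat_centralizer n Y"
  thus "P * (Q * B * P) * Q = B"
    using assms by (intro cancel_conjugation) (auto simp: mat_centralizer_def)
qed

lemma card_centralizer_le:
  fixes X Y :: "'a :: {field, finite} mat"
  assumes "X \<in> carrier_mat n n" "Y \<in> carrier_mat n n" "same_class_type X Y"
  shows "card (mat_centralizer n Y) \<le> card (mat_centralizer n X)"
proof -
  obtain P Q where PQ: "P \<in> carrier_mat n n" "Q \<in> carrier_mat n n" "P * Q = 1\<^sub>m n"
    and sub: "(\<lambda>B. Q * B * P) ` mat_centralizer n Y \<subseteq> mat_centralizer n X"
    using same_class_type_centralizer_embedding[OF assms] by blast
  show ?thesis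
    by (rule card_inj_on_le[OF inj_on_conjugation[OF PQ] sub])
       (rule finite_subset[OF _ finite_carrier_mat[of n n]], auto simp: mat_centralizer_def)
qed

theorem theorem2p7:
  fixes X Y :: "'a :: {field, finite} mat" and n :: nat
  assumes "X \<in> carrier_mat n n" and "Y \<in> carrier_mat n n"
    and "same_class_type X Y"
  shows "\<exists>P \<in> carrier_mat n n. \<exists>Q \<in> carrier_mat n n.
           inverts_mat P Q \<and> inverts_mat Q P \<and>
           mat_centralizer n Y = (\<lambda>A. P * A * Q) ` mat_centralizer n X"
proof -
  obtain P Q where P: "P \<in> carrier_mat n n" and Q: "Q \<in> carrier_mat n n"
    and inv: "P * Q = 1\<^sub>m n" "Q * P = 1\<^sub>m n"
    and sub: "(\<lambda>B. Q * B * P) ` mat_centralizer n Y \<subseteq> mat_centralizer n X" (is "?c ` ?CY \<subseteq> ?CX")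
    using same_class_type_centralizer_embedding[OF assms] by blast
  \<comment> \<open>The reverse embedding comes from another polynomial and another conjugating
    matrix, unrelated to \<open>P\<close>; only its inequality of cardinalities is used.\<close>
  have "same_class_type Y X" using assms(3) unfolding same_class_type_def by blast
  hence "card ?CX \<le> card ?CY" using card_centralizer_le assms(1,2) by blast
  also have "\<dots> = card (?c ` ?CY)" using card_image[OF inj_on_conjugation[OF P Q inv(1)]] by simp
  finally have "?c ` ?CY = ?CX"
    using sub finite_subset[OF _ finite_carrier_mat[of n n], of ?CX]
    by (intro card_seteq) (auto simp: mat_centralizer_def)
  moreover have "P * (?c B) * Q = B" if "B \<in> ?CY" for B
    using that P Q inv(1) by (intro cancel_conjugation) (auto simp: mat_centralizer_def)
  ultimately have "?CY = (\<lambda>A. P * A * Q) ` ?CX" by force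
  moreover have "inverts_mat P Q" "inverts_mat Q P" using P Q inv by (auto simp: inverts_mat_def)
  ultimately show ?thesis using P Q by blast
qed

end
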